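(* Define the operator $K\colon L^1\to L^1$ by $$Ku=\lim_{\lambda\downarrow 0}BR(\lambda,A)u\quad\text{for } u\in L^1$$ (limit in $L^1$). Then the following hold: (1) $K$ is a positive contraction. (2) $K$ is stochastic if and only if the semigroup $\{S(t)\}_{t\ge0}$ generated by $A$ is strongly stable. (3) If $K$ is mean ergodic then $\{P(t)\}_{t\ge0}$ is stochastic.
   Context: $(E,\mathcal E,m)$ is a $\sigma$-finite measure space, $L^1=L^1(E,\mathcal E,m)$ with norm $\|\cdot\|$, $L^1_+$ is the cone of nonnegative elements of $L^1$, and for a linear subspace $\mathcal D\subseteq L^1$, $\mathcal D_+=\mathcal D\cap L^1_+$. Densities are the elements $u\in L^1_+$ with $\|u\|=1$; a linear operator on $L^1$ is stochastic if it maps densities to densities. A substochastic (resp. stochastic) semigroup is a strongly continuous semigroup of positive contractions (resp. stochastic operators) on $L^1$; a semigroup $\{S(t)\}_{t\ge0}$ is strongly stable if $\lim_{t\to\infty}S(t)u=0$ in $L^1$ for all $u\in L^1$. A linear operator $T$ on $L^1$ is mean ergodic if $\lim_{N\to\infty}\frac1N\sum_{n=0}^{N-1}T^nu$ exists in $L^1$ for all $u\in L^1$. $R(\lambda,A)=(\lambda-A)^{-1}$ is the resolvent. Standing assumptions: $(A,\mathcal D(A))$ and $(B,\mathcal D(B))$ are linear operators in $L^1$ such that: (G1) $(A,\mathcal D(A))$ generates a substochastic semigroup $\{S(t)\}_{t\ge0}$; (G2) $\mathcal D(B)\supseteq\mathcal D(A)$ and $Bu\ge0$ for $u\in\mathcal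 D(A)_+$; (G3) $\int_E(Au+Bu)\,dm=0$ for every $u\in\mathcal D(A)_+$. Under these assumptions (Kato--Voigt perturbation theorem) there is a smallest substochastic semigroup $\{P(t)\}_{t\ge0}$ on $L^1$ whose generator is an extension of $(A+B,\mathcal D(A))$ (smallest: $P(t)u\le \widetilde P(t)u$ for all $t\ge 0$, $u\in L^1_+$ and every such semigroup $\widetilde P$). Its generator $C$ is characterized by $R(\lambda,C)u=\lim_{N\to\infty}R(\lambda,A)\sum_{n=0}^N(BR(\lambda,A))^nu$ for $u\in L^1$, $\lambda>0$. This is the semigroup $\{P(t)\}_{t\ge0}$ of the claim. *)

theory Defs
  imports "HOL-Analysis.Analysis"
begin

text \<open>
  The elements of \<open>L\<^sup>1(M)\<close> are represented by integrable functions, and equality, order and operator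
  identities are understood almost everywhere. An operator acts on representatives; the condition
  \<open>cong\<close> in \<open>linear_operator\<close> says that it is well defined on classes.
\<close>

definition L1 :: "'a measure \<Rightarrow> ('a \<Rightarrow> real) set" where
  "L1 M = {u. integrable M u}"

definition L1_norm :: "'a measure \<Rightarrow> ('a \<Rightarrow> real) \<Rightarrow> real" where
  "L1_norm M u = (\<integral>x. \<bar>u x\<bar> \<partial>M)"

definition eq_ae :: "'a measure \<Rightarrow> ('a \<Rightarrow> real) \<Rightarrow> ('a \<Rightarrow> real) \<Rightarrow> bool" where
  "eq_ae M u v \<longleftrightarrow> (AE x in M. u x = v x)"

definition le_ae :: "'a measure \<Rightarrow> ('a \<Rightarrow> real) \<Rightarrow> ('a \<Rightarrow> real) \<Rightarrow> bool" where
  "le_ae M u v \<longleftrightarrow> (AE x in M. u x \<le> v x)"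

definition pos_cone :: "'a measure \<Rightarrow> ('a \<Rightarrow> real) set \<Rightarrow> ('a \<Rightarrow> real) set" where
  "pos_cone M D = {u \<in> D. le_ae M (\<lambda>_. 0) u}"

definition density_elem :: "'a measure \<Rightarrow> ('a \<Rightarrow> real) \<Rightarrow> bool" where
  "density_elem M u \<longleftrightarrow> u \<in> pos_cone M (L1 M) \<and> L1_norm M u = 1"

text \<open>
  Membership in \<open>L1 M\<close> is required explicitly, since the integral of a non-integrable function is \<open>0\<close>.
\<close>

definition L1_tendsto ::
  "'a measure \<Rightarrow> ('i \<Rightarrow> 'a \<Rightarrow> real) \<Rightarrow> ('a \<Rightarrow> real) \<Rightarrow> 'i filter \<Rightarrow> bool" where
  "L1_tendsto M f v F \<longleftrightarrow>
     v \<in> L1 M \<and> (\<forall>\<^sub>F i in F. f i \<in> L1 M) \<and>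
     ((\<lambda>i. L1_norm M (\<lambda>x. f i x - v x)) \<longlongrightarrow> 0) F"

definition L1_subspace :: "'a measure \<Rightarrow> ('a \<Rightarrow> real) set \<Rightarrow> bool" where
  "L1_subspace M D \<longleftrightarrow>
     D \<subseteq> L1 M \<and>
     (\<forall>u\<in>D. \<forall>v\<in>L1 M. eq_ae M u v \<longrightarrow> v \<in> D) \<and>
     (\<lambda>_. 0) \<in> D \<and>
     (\<forall>u\<in>D. \<forall>v\<in>D. (\<lambda>x. u x + v x) \<in> D) \<and>
     (\<forall>c. \<forall>u\<in>D. (\<lambda>x. c * u x) \<in> D)"

locale linear_operator =
  fixes M :: "'a measure" and D :: "('a \<Rightarrow> real) set" and T :: "('a \<Rightarrow> real) \<Rightarrow> 'a \<Rightarrow> real"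
  assumes subspace: "L1_subspace M D"
    and into_L1: "u \<in> D \<Longrightarrow> T u \<in> L1 M"
    and cong: "u \<in> D \<Longrightarrow> v \<in> D \<Longrightarrow> eq_ae M u v \<Longrightarrow> eq_ae M (T u) (T v)"
    and add: "u \<in> D \<Longrightarrow> v \<in> D \<Longrightarrow> eq_ae M (T (\<lambda>x. u x + v x)) (\<lambda>x. T u x + T v x)"
    and scale: "u \<in> D \<Longrightarrow> eq_ae M (T (\<lambda>x. c * u x)) (\<lambda>x. c * T u x)"

definition bounded_operator :: "'a measure \<Rightarrow> (('a \<Rightarrow> real) \<Rightarrow> 'a \<Rightarrow> real) \<Rightarrow> bool" where
  "bounded_operator M T \<longleftrightarrow>
     linear_operator M (L1 M) T \<and> (\<exists>c. \<forall>u\<in>L1 M. L1_norm M (T u) \<le> c * L1_norm M u)"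

definition positive_contraction :: "'a measure \<Rightarrow> (('a \<Rightarrow> real) \<Rightarrow> 'a \<Rightarrow> real) \<Rightarrow> bool" where
  "positive_contraction M T \<longleftrightarrow>
     linear_operator M (L1 M) T \<and>
     (\<forall>u\<in>pos_cone M (L1 M). T u \<in> pos_cone M (L1 M)) \<and>
     (\<forall>u\<in>L1 M. L1_norm M (T u) \<le> L1_norm M u)"

definition stochastic_operator :: "'a measure \<Rightarrow> (('a \<Rightarrow> real) \<Rightarrow> 'a \<Rightarrow> real) \<Rightarrow> bool" where
  "stochastic_operator M T \<longleftrightarrow>
     linear_operator M (L1 M) T \<and> (\<forall>u. density_elem M u \<longrightarrow> density_elem M (T u))"

definition mean_ergodic :: "'a measure \<Rightarrow> (('a \<Rightarrow> real) \<Rightarrow> 'a \<Rightarrow> real) \<Rightarrow> bool" where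
  "mean_ergodic M T \<longleftrightarrow>
     (\<forall>u\<in>L1 M. \<exists>v. L1_tendsto M (\<lambda>N x. (1 / real N) * (\<Sum>n<N. (T ^^ n) u x)) v sequentially)"

text \<open>Semigroups are families indexed by all reals; only the members with \<open>t \<ge> 0\<close> matter.\<close>

definition strongly_continuous_semigroup ::
  "'a measure \<Rightarrow> (real \<Rightarrow> ('a \<Rightarrow> real) \<Rightarrow> 'a \<Rightarrow> real) \<Rightarrow> bool" where
  "strongly_continuous_semigroup M S \<longleftrightarrow>
     (\<forall>t\<ge>0. bounded_operator M (S t)) \<and>
     (\<forall>u\<in>L1 M. eq_ae M (S 0 u) u) \<and>
     (\<forall>s\<ge>0. \<forall>t\<ge>0. \<forall>u\<in>L1 M. eq_ae M (S (s + t) u) (S s (S t u))) \<and>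
     (\<forall>u\<in>L1 M. L1_tendsto M (\<lambda>t. S t u) u (at_right 0))"

definition substochastic_semigroup ::
  "'a measure \<Rightarrow> (real \<Rightarrow> ('a \<Rightarrow> real) \<Rightarrow> 'a \<Rightarrow> real) \<Rightarrow> bool" where
  "substochastic_semigroup M S \<longleftrightarrow>
     strongly_continuous_semigroup M S \<and> (\<forall>t\<ge>0. positive_contraction M (S t))"

definition stochastic_semigroup ::
  "'a measure \<Rightarrow> (real \<Rightarrow> ('a \<Rightarrow> real) \<Rightarrow> 'a \<Rightarrow> real) \<Rightarrow> bool" where
  "stochastic_semigroup M S \<longleftrightarrow>
     strongly_continuous_semigroup M S \<and> (\<forall>t\<ge>0. stochastic_operator M (S t))"

definition strongly_stable ::
  "'a measure \<Rightarrow> (real \<Rightarrow> ('a \<Rightarrow> real) \<Rightarrow> 'a \<Rightarrow> real) \<Rightarrow> bool" where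
  "strongly_stable M S \<longleftrightarrow> (\<forall>u\<in>L1 M. L1_tendsto M (\<lambda>t. S t u) (\<lambda>_. 0) at_top)"

text \<open>
  \<open>(A, D)\<close> is the infinitesimal generator of \<open>S\<close>: its domain consists of those \<open>u\<close> for which the
  difference quotients at \<open>0\<close> converge, and \<open>A u\<close> is their limit.
\<close>

definition generates ::
  "'a measure \<Rightarrow> ('a \<Rightarrow> real) set \<Rightarrow> (('a \<Rightarrow> real) \<Rightarrow> 'a \<Rightarrow> real) \<Rightarrow>
   (real \<Rightarrow> ('a \<Rightarrow> real) \<Rightarrow> 'a \<Rightarrow> real) \<Rightarrow> bool" where
  "generates M D A S \<longleftrightarrow>
     linear_operator M D A \<and>
     D = {u \<in> L1 M. \<exists>v. L1_tendsto M (\<lambda>t x. (S t u x - u x) / t) v (at_right 0)} \<and>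
     (\<forall>u\<in>D. L1_tendsto M (\<lambda>t x. (S t u x - u x) / t) (A u) (at_right 0))"

text \<open>
  \<open>(\<lambda> - A)\<^sup>-\<^sup>1 u\<close>. When \<open>\<lambda> - A\<close> is bijective, the chosen representative is unique
  almost everywhere.
\<close>

definition resolvent ::
  "'a measure \<Rightarrow> ('a \<Rightarrow> real) set \<Rightarrow> (('a \<Rightarrow> real) \<Rightarrow> 'a \<Rightarrow> real) \<Rightarrow>
   real \<Rightarrow> ('a \<Rightarrow> real) \<Rightarrow> 'a \<Rightarrow> real" where
  "resolvent M D A l u = (SOME v. v \<in> D \<and> eq_ae M (\<lambda>x. l * v x - A v x) u)"

text \<open>
  \<open>K u = lim\<^sub>\<lambda>\<^sub>\<down>\<^sub>0 B R(\<lambda>, A) u\<close>, as a representative of the \<open>L\<^sup>1\<close>-limit.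
\<close>

definition K_operator ::
  "'a measure \<Rightarrow> ('a \<Rightarrow> real) set \<Rightarrow> (('a \<Rightarrow> real) \<Rightarrow> 'a \<Rightarrow> real) \<Rightarrow>
   (('a \<Rightarrow> real) \<Rightarrow> 'a \<Rightarrow> real) \<Rightarrow> ('a \<Rightarrow> real) \<Rightarrow> 'a \<Rightarrow> real" where
  "K_operator M D A B u =
     (SOME v. L1_tendsto M (\<lambda>l. B (resolvent M D A l u)) v (at_right 0))"

definition generator_extends_sum ::
  "'a measure \<Rightarrow> ('a \<Rightarrow> real) set \<Rightarrow> (('a \<Rightarrow> real) \<Rightarrow> 'a \<Rightarrow> real) \<Rightarrow>
   (('a \<Rightarrow> real) \<Rightarrow> 'a \<Rightarrow> real) \<Rightarrow> (real \<Rightarrow> ('a \<Rightarrow> real) \<Rightarrow> 'a \<Rightarrow> real) \<Rightarrow> bool" where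
  "generator_extends_sum M D A B P \<longleftrightarrow>
     (\<exists>D\<^sub>C C. generates M D\<^sub>C C P \<and> D \<subseteq> D\<^sub>C \<and> (\<forall>u\<in>D. eq_ae M (C u) (\<lambda>x. A u x + B u x)))"

definition smallest_perturbed_semigroup ::
  "'a measure \<Rightarrow> ('a \<Rightarrow> real) set \<Rightarrow> (('a \<Rightarrow> real) \<Rightarrow> 'a \<Rightarrow> real) \<Rightarrow>
   (('a \<Rightarrow> real) \<Rightarrow> 'a \<Rightarrow> real) \<Rightarrow> (real \<Rightarrow> ('a \<Rightarrow> real) \<Rightarrow> 'a \<Rightarrow> real) \<Rightarrow> bool" where
  "smallest_perturbed_semigroup M D A B P \<longleftrightarrow>
     substochastic_semigroup M P \<and> generator_extends_sum M D A B P \<and>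
     (\<forall>Q. substochastic_semigroup M Q \<and> generator_extends_sum M D A B Q \<longrightarrow>
        (\<forall>t\<ge>0. \<forall>u\<in>pos_cone M (L1 M). le_ae M (P t u) (Q t u)))"

end

theory Submission
  imports Defs "HOL-Probability.Discrete_Topology"
begin

text \<open>
  Write \<open>R\<^sub>\<lambda>\<close> for the resolvent of \<open>A\<close>, \<open>T\<^sub>\<lambda> = B R\<^sub>\<lambda>\<close>, and \<open>J\<close> for the integral, which on the positive cone
  is the norm. Integrating \<open>A v + B v\<close> for \<open>v = R\<^sub>\<lambda> u\<close>, \<open>u \<ge> 0\<close>, turns the balance condition into
  \<open>\<parallel>T\<^sub>\<lambda> u\<parallel> = \<parallel>u\<parallel> - \<lambda> \<parallel>R\<^sub>\<lambda> u\<parallel>\<close> (lemma \<open>norm_T\<close>). By the resolvent identity \<open>T\<^sub>\<lambda> u\<close> increases as \<open>\<lambda>\<close>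
  decreases, so monotone convergence gives the limit \<open>K u\<close>, and \<open>K\<close> is a positive contraction.

  For the second claim, consider the functional \<open>c = J - J \<circ> K\<close>, so that
  \<open>c u = lim \<lambda> \<parallel>R\<^sub>\<lambda> u\<parallel>\<close> as \<open>\<lambda> \<down> 0\<close> for \<open>u \<ge> 0\<close>. Since \<open>K A v = - B v\<close> on the domain (\<open>K_gen\<close>), the balance condition
  says that \<open>c\<close> vanishes on the range of \<open>A\<close>, hence is invariant under \<open>S\<close>
  (\<open>invariant_functional\<close>). If \<open>S\<close> is stable, then \<open>c u = c (S t u) \<rightarrow> 0\<close>, so \<open>K\<close> preserves the norm of
  positive elements. Conversely the functional \<open>L u = lim J (S t u)\<close> as \<open>t \<rightarrow> \<infinity>\<close> also vanishes on the range
  of \<open>A\<close>, so \<open>L u = \<lambda> L (R\<^sub>\<lambda> u) \<le> \<lambda> \<parallel>R\<^sub>\<lambda> u\<parallel>\<close> for \<open>u \<ge> 0\<close>, and the right side tends to \<open>c u\<close>, which is \<open>0\<close> when \<open>K\<close> is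
  stochastic.

  For the third claim, let \<open>f \<ge> 0\<close> and let \<open>v = K v\<close> be the limit of the means of \<open>K\<^sup>n f\<close>. As
  \<open>T\<^sub>\<lambda> \<le> K\<close>, the sequence \<open>T\<^sub>\<lambda>\<^sup>n v\<close> decreases to a fixed point of \<open>T\<^sub>\<lambda>\<close>, which is \<open>0\<close> because
  \<open>\<parallel>T\<^sub>\<lambda> g\<parallel> = \<parallel>g\<parallel>\<close> forces \<open>R\<^sub>\<lambda> g = 0\<close>. The means of \<open>T\<^sub>\<lambda>\<^sup>n f\<close> are dominated by those of \<open>K\<^sup>n f\<close>, so
  \<open>T\<^sub>\<lambda>\<^sup>n f \<rightarrow> 0\<close> (\<open>mean_ergodic_imp_T_power_null\<close>). Now \<open>v\<^sub>n = R\<^sub>\<lambda> (f + T\<^sub>\<lambda> f + \<dots> + T\<^sub>\<lambda>\<^sup>n\<^sup>-\<^sup>1 f)\<close> lies in the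
  domain of \<open>A\<close> and satisfies \<open>(\<lambda> - A - B) v\<^sub>n = f - T\<^sub>\<lambda>\<^sup>n f\<close>. For the generator \<open>C\<close> of any substochastic
  semigroup \<open>P\<close> extending \<open>A + B\<close> this means \<open>v\<^sub>n = R(\<lambda>, C) (f - T\<^sub>\<lambda>\<^sup>n f)\<close>; the balance condition
  on \<open>v\<^sub>n\<close> and the limit \<open>n \<rightarrow> \<infinity>\<close> give \<open>\<lambda> J (R(\<lambda>, C) f) = J f\<close>. So \<open>J\<close> vanishes on the range of \<open>C\<close> and
  is invariant under \<open>P\<close>, that is, \<open>P\<close> is stochastic.

  The argument runs in an abstract ordered normed space (\<open>L_space\<close>) where almost everywhere
  equality has become equality; \<open>L\<^sup>1(M)\<close> is put into this form by an isometry onto a closed subspace of a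
  space of bounded functions. The resolvent of a generator is obtained as the limit of the resolvents of the
  difference quotients \<open>(S h - 1) / h\<close> for \<open>h = 2\<^sup>-\<^sup>n\<close> (\<open>resolvent_exists\<close>).
\<close>

section \<open>Abstract L-spaces\<close>

text \<open>
  The features of \<open>L\<^sup>1\<close> on which the proof rests: the norm is additive on the positive cone, every element is a
  difference of positive elements with norms adding up (positive and negative part), and bounded
  increasing sequences converge. The carrier is a subset \<open>X\<close> of a normed type, because \<open>L\<^sup>1(M)\<close>
  depends on the term \<open>M\<close> and so is not itself a type.
\<close>
locale L_space =
  fixes X Pos :: "'z::real_normed_vector set"
  assumes subspace_X: "subspace X"
    and Pos_subset: "Pos \<subseteq> X"
    and Pos_add: "x \<in> Pos \<Longrightarrow> y \<in> Pos \<Longrightarrow> x + y \<in> Pos"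
    and Pos_scale: "0 \<le> c \<Longrightarrow> x \<in> Pos \<Longrightarrow> c *\<^sub>R x \<in> Pos"
    and norm_add_Pos: "x \<in> Pos \<Longrightarrow> y \<in> Pos \<Longrightarrow> norm (x + y) = norm x + norm y"
    and Jordan: "x \<in> X \<Longrightarrow> \<exists>p\<in>Pos. \<exists>q\<in>Pos. x = p - q \<and> norm x = norm p + norm q"
    and monotone_convergence:
      "(\<And>n. f n \<in> Pos) \<Longrightarrow> (\<And>n. f (Suc n) - f n \<in> Pos) \<Longrightarrow> (\<And>n. norm (f n) \<le> c) \<Longrightarrow>
        \<exists>l\<in>X. f \<longlonglongrightarrow> l"
begin

lemma PosX: "x \<in> Pos \<Longrightarrow> x \<in> X"
  using Pos_subset by blast

lemmas X_intros [simp, intro] =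
  subspace_add [OF subspace_X] subspace_diff [OF subspace_X] subspace_scale [OF subspace_X] subspace_neg [OF subspace_X]
  subspace_0 [OF subspace_X] subspace_sum [OF subspace_X] PosX

lemma Pos_0 [simp, intro]: "0 \<in> Pos"
proof -
  obtain p where "p \<in> Pos" using Jordan [of 0] by auto
  then show ?thesis using Pos_scale [of 0 p] by simp
qed

lemma Pos_sum: "(\<And>i. i \<in> I \<Longrightarrow> f i \<in> Pos) \<Longrightarrow> sum f I \<in> Pos"
  by (induction I rule: infinite_finite_induct) (auto intro: Pos_add)

lemma norm_sum_Pos: "(\<And>i. i \<in> I \<Longrightarrow> f i \<in> Pos) \<Longrightarrow> norm (sum f I) = (\<Sum>i\<in>I. norm (f i))"
  by (induction I rule: infinite_finite_induct) (auto simp: norm_add_Pos Pos_sum)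

lemma norm_mono_Pos:
  assumes "x \<in> Pos" "y - x \<in> Pos"
  shows "norm x \<le> norm y"
  using norm_add_Pos [OF assms] norm_ge_zero [of "y - x"] by simp

lemma Pos_trans: "y - x \<in> Pos \<Longrightarrow> z - y \<in> Pos \<Longrightarrow> z - x \<in> Pos"
  using Pos_add [of "y - x" "z - y"] by simp

text \<open>
  For a limit \<open>x = p - q\<close> of positive \<open>f n\<close>, additivity of the norm gives
  \<open>\<parallel>f n + q\<parallel> = \<parallel>f n\<parallel> + \<parallel>q\<parallel>\<close>, in the limit \<open>\<parallel>p\<parallel> = \<parallel>p\<parallel> + 2 \<parallel>q\<parallel>\<close>, so the negative part vanishes.
\<close>
lemma Pos_limit:
  assumes lim: "(f \<longlongrightarrow> x) F" and ev: "\<forall>\<^sub>F n in F. f n \<in> Pos" and "x \<in> X" and F: "F \<noteq> bot"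
  shows "x \<in> Pos"
proof -
  obtain p q where pq: "p \<in> Pos" "q \<in> Pos" "x = p - q" "norm x = norm p + norm q"
    using Jordan [OF \<open>x \<in> X\<close>] by blast
  have B: "((\<lambda>n. norm (f n) + norm q) \<longlongrightarrow> norm x + norm q) F"
    by (intro tendsto_intros lim)
  have "((\<lambda>n. norm (f n + q)) \<longlongrightarrow> norm (x + q)) F"
    by (intro tendsto_intros lim)
  moreover have "((\<lambda>n. norm (f n + q)) \<longlongrightarrow> norm x + norm q) F"
  proof (rule Lim_transform_eventually [OF B])
    show "\<forall>\<^sub>F n in F. norm (f n) + norm q = norm (f n + q)"
      using ev by eventually_elim (simp add: norm_add_Pos pq)
  qed
  ultimately have "norm (x + q) = norm x + norm q"
    by (rule tendsto_unique [OF F])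
  then have "norm q = 0"
    using pq norm_ge_zero [of q] by simp
  then show ?thesis using pq by simp
qed

lemma increasing_le_limit:
  assumes inc: "\<And>n. f (Suc n) - f n \<in> Pos" and lim: "f \<longlonglongrightarrow> l" and X: "l \<in> X" "\<And>n. f n \<in> X"
  shows "l - f m \<in> Pos"
proof (rule Pos_limit)
  show "(\<lambda>n. f n - f m) \<longlonglongrightarrow> l - f m" by (intro tendsto_intros lim)
  have "f (m + k) - f m \<in> Pos" for k
  proof (induction k)
    case (Suc k)
    then show ?case using Pos_trans [OF _ inc, of "m + k" "f m"] by simp
  qed simp
  then show "\<forall>\<^sub>F n in sequentially. f n - f m \<in> Pos"
    by (intro eventually_sequentiallyI [of m]) (metis le_add_diff_inverse)
qed (simp_all add: X)

text \<open>The integral: the linear functional that extends the norm of the positive cone.\<close>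
definition J :: "'z \<Rightarrow> real" where
  "J x = (THE r. \<exists>p\<in>Pos. \<exists>q\<in>Pos. x = p - q \<and> r = norm p - norm q)"

lemma J_diff_Pos:
  assumes "p \<in> Pos" "q \<in> Pos"
  shows "J (p - q) = norm p - norm q"
  unfolding J_def
proof (rule the_equality)
  fix r assume "\<exists>p'\<in>Pos. \<exists>q'\<in>Pos. p - q = p' - q' \<and> r = norm p' - norm q'"
  then obtain p' q' where *: "p' \<in> Pos" "q' \<in> Pos" "p - q = p' - q'" "r = norm p' - norm q'"
    by blast
  then have "p + q' = p' + q" by (simp add: algebra_simps)
  then have "norm p + norm q' = norm p' + norm q"
    using norm_add_Pos [of p q'] norm_add_Pos [of p' q] * assms by simp
  then show "r = norm p - norm q" using * by simp
qed (use assms in blast)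

lemma J_Pos: "p \<in> Pos \<Longrightarrow> J p = norm p"
  using J_diff_Pos [of p 0] by simp

lemma J_add:
  assumes "x \<in> X" "y \<in> X"
  shows "J (x + y) = J x + J y"
proof -
  obtain p q where x: "p \<in> Pos" "q \<in> Pos" "x = p - q" using Jordan [OF assms(1)] by blast
  obtain p' q' where y: "p' \<in> Pos" "q' \<in> Pos" "y = p' - q'" using Jordan [OF assms(2)] by blast
  have "J (x + y) = J ((p + p') - (q + q'))" unfolding x y by (simp add: algebra_simps)
  then show ?thesis using x y by (simp add: J_diff_Pos Pos_add norm_add_Pos)
qed

lemma J_minus:
  assumes "x \<in> X" shows "J (- x) = - J x"
  using J_add [of x "- x"] assms subspace_neg [OF subspace_X assms] J_Pos [of 0] by simp

lemma J_scale:
  assumes "x \<in> X"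
  shows "J (c *\<^sub>R x) = c * J x"
proof -
  have *: "J (c *\<^sub>R x) = c * J x" if "0 \<le> c" for c
  proof -
    obtain p q where x: "p \<in> Pos" "q \<in> Pos" "x = p - q" using Jordan [OF assms(1)] by blast
    have "J (c *\<^sub>R x) = J (c *\<^sub>R p - c *\<^sub>R q)" unfolding x by (simp add: algebra_simps)
    also have "\<dots> = c * (norm p - norm q)"
      using x that by (simp add: J_diff_Pos Pos_scale algebra_simps)
    also have "\<dots> = c * J x" using x by (simp add: J_diff_Pos)
    finally show ?thesis .
  qed
  show ?thesis
  proof (cases "0 \<le> c")
    case False
    then have "J ((- c) *\<^sub>R x) = (- c) * J x" by (intro *) simp
    then show ?thesis using J_minus [of "c *\<^sub>R x"] assms by simp
  qed (rule *)
qed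

lemma abs_J_le:
  assumes "x \<in> X" shows "\<bar>J x\<bar> \<le> norm x"
proof -
  obtain p q where x: "p \<in> Pos" "q \<in> Pos" "x = p - q" "norm x = norm p + norm q"
    using Jordan [OF assms(1)] by blast
  then have "J x = norm p - norm q" by (simp add: J_diff_Pos)
  then show ?thesis using x(4) norm_ge_zero [of p] norm_ge_zero [of q] by linarith
qed

text \<open>
  Pass to a subsequence with summable increments; the positive and the negative parts of the increments
  then have increasing bounded partial sums, which converge by monotone convergence.
\<close>
lemma complete_X: "complete X"
  unfolding complete_def
proof (intro allI impI, elim conjE)
  fix f assume X: "\<forall>n. f n \<in> X" and C: "Cauchy f"
  have "\<forall>k. \<exists>N. \<forall>m\<ge>N. \<forall>n\<ge>N. norm (f m - f n) < (1/2) ^ k"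
    using C [unfolded Cauchy_iff] by simp
  then obtain N where N: "\<And>k m n. m \<ge> N k \<Longrightarrow> n \<ge> N k \<Longrightarrow> norm (f m - f n) < (1/2) ^ k"
    by (subst (asm) choice_iff) blast
  \<comment> \<open>Partial sums make the indices increasing while keeping \<open>r k \<ge> N k\<close>.\<close>
  define r where "r k = (\<Sum>i\<le>k. N i)" for k
  have rN: "r k \<ge> N k" for k
    unfolding r_def by (rule member_le_sum) auto
  have r_Suc: "r (Suc k) \<ge> N k" for k
    using rN [of k] by (simp add: r_def)
  define d where "d k = f (r (Suc k)) - f (r k)" for k
  have dX: "d k \<in> X" for k using X by (simp add: d_def)
  have nd: "norm (d k) \<le> (1/2) ^ k" for k
    unfolding d_def using N [OF r_Suc rN, of k] by simp
  obtain p q where pq: "\<And>k. p k \<in> Pos" "\<And>k. q k \<in> Pos" "\<And>k. d k = p k - q k"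
      "\<And>k. norm (d k) = norm (p k) + norm (q k)"
  proof -
    have "\<forall>k. \<exists>z. fst z \<in> Pos \<and> snd z \<in> Pos \<and> d k = fst z - snd z \<and> norm (d k) = norm (fst z) + norm (snd z)"
      using Jordan [OF dX] by (metis fst_conv snd_conv)
    then obtain z where "\<forall>k. fst (z k) \<in> Pos \<and> snd (z k) \<in> Pos \<and> d k = fst (z k) - snd (z k)
        \<and> norm (d k) = norm (fst (z k)) + norm (snd (z k))"
      by (subst (asm) choice_iff) blast
    then show ?thesis using that [of "\<lambda>k. fst (z k)" "\<lambda>k. snd (z k)"] by blast
  qed
  have part: "\<exists>l\<in>X. (\<lambda>n. \<Sum>k<n. s k) \<longlonglongrightarrow> l"
    if s: "\<And>k. s k \<in> Pos" and le: "\<And>k. norm (s k) \<le> norm (d k)" for s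
  proof (rule monotone_convergence [where c = 2])
    fix n
    show "(\<Sum>k<n. s k) \<in> Pos" by (intro Pos_sum s)
    show "(\<Sum>k<Suc n. s k) - (\<Sum>k<n. s k) \<in> Pos" using s by simp
    have "norm (\<Sum>k<n. s k) \<le> (\<Sum>k<n. (1/2) ^ k :: real)"
      by (rule norm_sum [THEN order_trans], rule sum_mono) (use le nd in \<open>blast intro: order_trans\<close>)
    also have "\<dots> \<le> 2"
      using sum_gp_strict [of "1/2 :: real" n] by simp
    finally show "norm (\<Sum>k<n. s k) \<le> 2" .
  qed
  obtain a where a: "a \<in> X" "(\<lambda>n. \<Sum>k<n. p k) \<longlonglongrightarrow> a"
    using part [of p] pq(1,4) by auto
  obtain b where b: "b \<in> X" "(\<lambda>n. \<Sum>k<n. q k) \<longlonglongrightarrow> b"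
    using part [of q] pq(2,4) by auto
  define l where "l = f (r 0) + a - b"
  have "f (r n) = f (r 0) + (\<Sum>k<n. p k) - (\<Sum>k<n. q k)" for n
  proof -
    have "f (r n) - f (r 0) = (\<Sum>k<n. d k)"
      unfolding d_def by (rule sum_lessThan_telescope [symmetric])
    then show ?thesis by (simp add: pq(3) sum_subtractf algebra_simps)
  qed
  then have "(\<lambda>n. f (r n)) = (\<lambda>n. f (r 0) + (\<Sum>k<n. p k) - (\<Sum>k<n. q k))" by (rule ext)
  moreover have "(\<lambda>n. f (r 0) + (\<Sum>k<n. p k) - (\<Sum>k<n. q k)) \<longlonglongrightarrow> l"
    unfolding l_def by (intro tendsto_diff tendsto_add tendsto_const a b)
  ultimately have fr: "(\<lambda>n. f (r n)) \<longlonglongrightarrow> l" by simp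
  have "f \<longlonglongrightarrow> l"
  proof (rule LIMSEQ_I)
    fix e :: real assume "0 < e"
    then obtain k0 where k0: "(1/2) ^ k0 < e / 2"
      using real_arch_pow_inv [of "e / 2" "1/2"] by auto
    obtain k1 where k1: "\<And>k. k \<ge> k1 \<Longrightarrow> norm (f (r k) - l) < e / 2"
      using LIMSEQ_D [OF fr, of "e / 2"] \<open>0 < e\<close> by auto
    define k where "k = max k0 k1"
    have k: "(1/2) ^ k < e / 2"
      using power_decreasing [of k0 k "1/2 :: real"] by (intro le_less_trans [OF _ k0]) (simp add: k_def)
    have "norm (f n - l) < e" if "n \<ge> N k" for n
    proof -
      have "norm (f n - l) \<le> norm (f n - f (r k)) + norm (f (r k) - l)"
        using norm_triangle_ineq [of "f n - f (r k)" "f (r k) - l"] by simp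
      also have "\<dots> < e / 2 + e / 2"
        using N [OF that rN] k k1 [of k] by (intro add_strict_mono) (auto simp: k_def)
      finally show ?thesis by simp
    qed
    then show "\<exists>no. \<forall>n\<ge>no. norm (f n - l) < e" by blast
  qed
  moreover have "l \<in> X" using a b X by (simp add: l_def)
  ultimately show "\<exists>l\<in>X. f \<longlonglongrightarrow> l" by blast
qed

subsection \<open>Positive contractions\<close>

definition linear_on_X :: "('z \<Rightarrow> 'v::real_vector) \<Rightarrow> bool" where
  "linear_on_X T \<longleftrightarrow> (\<forall>x\<in>X. \<forall>y\<in>X. T (x + y) = T x + T y) \<and> (\<forall>c. \<forall>x\<in>X. T (c *\<^sub>R x) = c *\<^sub>R T x)"

lemma linear_on_X_scale: "linear_on_X T \<Longrightarrow> x \<in> X \<Longrightarrow> T (c *\<^sub>R x) = c *\<^sub>R T x"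
  by (simp add: linear_on_X_def)

lemma linear_on_X_add: "linear_on_X T \<Longrightarrow> x \<in> X \<Longrightarrow> y \<in> X \<Longrightarrow> T (x + y) = T x + T y"
  by (simp add: linear_on_X_def)

lemma linear_on_X_0: "linear_on_X T \<Longrightarrow> T 0 = 0"
  using linear_on_X_scale [of T 0 0] by simp

lemma linear_on_X_diff: "linear_on_X T \<Longrightarrow> x \<in> X \<Longrightarrow> y \<in> X \<Longrightarrow> T (x - y) = T x - T y"
  using linear_on_X_add [of T x "(-1) *\<^sub>R y"] linear_on_X_scale [of T y "-1"]
    subspace_neg [OF subspace_X] by simp

lemma linear_on_X_sum:
  assumes "linear_on_X T" "\<And>i. i \<in> I \<Longrightarrow> f i \<in> X"
  shows "T (sum f I) = (\<Sum>i\<in>I. T (f i))"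
  using assms(2)
proof (induction I rule: infinite_finite_induct)
  case (insert i I)
  have "T (f i + sum f I) = T (f i) + T (sum f I)"
    by (rule linear_on_X_add [OF assms(1)]) (use insert.prems in auto)
  then show ?case using insert by simp
qed (auto simp: linear_on_X_0 [OF assms(1)])

lemma linear_J: "linear_on_X J"
  by (simp add: linear_on_X_def J_add J_scale)

lemma J_diff: "x \<in> X \<Longrightarrow> y \<in> X \<Longrightarrow> J (x - y) = J x - J y"
  by (rule linear_on_X_diff [OF linear_J])

text \<open>A bound on the positive cone suffices, as the norms of the positive and negative parts add up.\<close>
lemma functional_bound:
  fixes T :: "'z \<Rightarrow> 'v::real_normed_vector"
  assumes "linear_on_X T" "\<And>p. p \<in> Pos \<Longrightarrow> norm (T p) \<le> norm p" "x \<in> X"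
  shows "norm (T x) \<le> norm x"
proof -
  obtain p q where x: "p \<in> Pos" "q \<in> Pos" "x = p - q" "norm x = norm p + norm q"
    using Jordan [OF assms(3)] by blast
  have "norm (T x) \<le> norm (T p) + norm (T q)"
    using x assms(1) linear_on_X_diff [of T p q] by (simp add: norm_triangle_ineq4)
  then show ?thesis using x assms(2) [of p] assms(2) [of q] by simp
qed

definition pos_contr :: "('z \<Rightarrow> 'z) \<Rightarrow> bool" where
  "pos_contr T \<longleftrightarrow> linear_on_X T \<and> (\<forall>p\<in>Pos. T p \<in> Pos \<and> norm (T p) \<le> norm p)"

lemma
  assumes "pos_contr T"
  shows pc_linear: "linear_on_X T"
    and pc_add: "x \<in> X \<Longrightarrow> y \<in> X \<Longrightarrow> T (x + y) = T x + T y"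
    and pc_diff: "x \<in> X \<Longrightarrow> y \<in> X \<Longrightarrow> T (x - y) = T x - T y"
    and pc_scale: "x \<in> X \<Longrightarrow> T (c *\<^sub>R x) = c *\<^sub>R T x"
    and pc_Pos: "p \<in> Pos \<Longrightarrow> T p \<in> Pos"
    and pc_norm: "x \<in> X \<Longrightarrow> norm (T x) \<le> norm x"
proof -
  show lin: "linear_on_X T" using assms by (simp add: pos_contr_def)
  show "x \<in> X \<Longrightarrow> y \<in> X \<Longrightarrow> T (x + y) = T x + T y"
    by (rule linear_on_X_add [OF lin])
  show "x \<in> X \<Longrightarrow> y \<in> X \<Longrightarrow> T (x - y) = T x - T y"
    by (rule linear_on_X_diff [OF lin])
  show "x \<in> X \<Longrightarrow> T (c *\<^sub>R x) = c *\<^sub>R T x"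
    by (rule linear_on_X_scale [OF lin])
  show "p \<in> Pos \<Longrightarrow> T p \<in> Pos" using assms by (simp add: pos_contr_def)
  show "x \<in> X \<Longrightarrow> norm (T x) \<le> norm x"
    by (rule functional_bound [OF lin]) (use assms in \<open>simp_all add: pos_contr_def\<close>)
qed

lemma pc_X:
  assumes "pos_contr T" "x \<in> X" shows "T x \<in> X"
proof -
  obtain p q where x: "p \<in> Pos" "q \<in> Pos" "x = p - q"
    using Jordan [OF assms(2)] by blast
  then show ?thesis using pc_diff [OF assms(1), of p q] pc_Pos [OF assms(1)] by auto
qed

lemma pc_tendsto:
  assumes "pos_contr T" "(f \<longlongrightarrow> l) F" "\<And>i. f i \<in> X" "l \<in> X"
  shows "((\<lambda>i. T (f i)) \<longlongrightarrow> T l) F"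
proof -
  have "((\<lambda>i. T (f i) - T l) \<longlongrightarrow> 0) F"
  proof (rule Lim_null_comparison)
    show "\<forall>\<^sub>F i in F. norm (T (f i) - T l) \<le> norm (f i - l)"
      using pc_norm [OF assms(1), of "f _ - l"] assms by (simp add: pc_diff)
    show "((\<lambda>i. norm (f i - l)) \<longlongrightarrow> 0) F"
      using assms(2) by (simp add: LIM_zero tendsto_norm_zero)
  qed
  then show ?thesis by (simp add: LIM_zero_iff)
qed

lemma pc_funpow: "pos_contr T \<Longrightarrow> pos_contr (T ^^ n)"
proof (induction n)
  case (Suc n)
  note pc = Suc.IH [OF Suc.prems]
  have "linear_on_X (T ^^ Suc n)"
    unfolding linear_on_X_def
    by (simp add: pc_add [OF pc] pc_scale [OF pc] pc_add [OF Suc.prems] pc_scale [OF Suc.prems]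
        pc_X [OF pc])
  moreover have "(T ^^ Suc n) p \<in> Pos" "norm ((T ^^ Suc n) p) \<le> norm p" if "p \<in> Pos" for p
    using that pc_Pos [OF pc that] pc_Pos [OF Suc.prems]
      pc_norm [OF pc, of p] pc_norm [OF Suc.prems, of "(T ^^ n) p"] by auto
  ultimately show ?case unfolding pos_contr_def by blast
qed (simp add: pos_contr_def linear_on_X_def)

text \<open>
  The norm of the negative part. It is sublinear, and a positive contraction does not increase it, so it
  can be used to prove that an element is positive where no lattice operations are at hand.
\<close>
definition neg_mass :: "'z \<Rightarrow> real" where
  "neg_mass x = (norm x - J x) / 2"

lemma neg_mass_Pos: "p \<in> Pos \<Longrightarrow> neg_mass p = 0"
  by (simp add: neg_mass_def J_Pos)

lemma neg_mass_add: "x \<in> X \<Longrightarrow> y \<in> X \<Longrightarrow> neg_mass (x + y) \<le> neg_mass x + neg_mass y"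
  using norm_triangle_ineq [of x y] by (simp add: neg_mass_def J_add field_simps)

lemma neg_mass_scale: "0 \<le> c \<Longrightarrow> x \<in> X \<Longrightarrow> neg_mass (c *\<^sub>R x) = c * neg_mass x"
  by (simp add: neg_mass_def J_scale algebra_simps)

lemma neg_mass_le_norm: "x \<in> X \<Longrightarrow> neg_mass x \<le> norm x"
  using abs_J_le [of x] by (simp add: neg_mass_def)

lemma neg_mass_nonneg: "x \<in> X \<Longrightarrow> 0 \<le> neg_mass x"
  using abs_J_le [of x] by (simp add: neg_mass_def)

lemma neg_mass_pc:
  assumes "pos_contr T" "x \<in> X"
  shows "neg_mass (T x) \<le> neg_mass x"
proof -
  obtain p q where x: "p \<in> Pos" "q \<in> Pos" "x = p - q" "norm x = norm p + norm q"
    using Jordan [OF assms(2)] by blast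
  have "norm (T x) \<le> norm (T p) + norm (T q)" "J (T x) = norm (T p) - norm (T q)"
    using x pc_diff [OF assms(1), of p q] pc_Pos [OF assms(1)]
    by (auto simp: norm_triangle_ineq4 J_diff_Pos)
  then have "neg_mass (T x) \<le> norm (T q)" by (simp add: neg_mass_def)
  also have "\<dots> \<le> norm q" using x by (intro pc_norm [OF assms(1)]) auto
  also have "\<dots> = neg_mass x" using x J_diff_Pos [of p q] by (simp add: neg_mass_def)
  finally show ?thesis .
qed

lemma neg_mass_0_Pos:
  assumes "x \<in> X" "neg_mass x = 0"
  shows "x \<in> Pos"
proof -
  obtain p q where x: "p \<in> Pos" "q \<in> Pos" "x = p - q" "norm x = norm p + norm q"
    using Jordan [OF assms(1)] by blast
  then have "norm q = 0" using assms(2) J_diff_Pos [of p q] by (simp add: neg_mass_def)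
  then show ?thesis using x by simp
qed

end

section \<open>Generators and resolvents of substochastic semigroups\<close>

locale substochastic = L_space X Pos for X Pos :: "'z::real_normed_vector set" +
  fixes S :: "real \<Rightarrow> 'z \<Rightarrow> 'z"
  assumes S_pc: "0 \<le> t \<Longrightarrow> pos_contr (S t)"
    and S_0: "x \<in> X \<Longrightarrow> S 0 x = x"
    and S_plus: "0 \<le> s \<Longrightarrow> 0 \<le> t \<Longrightarrow> x \<in> X \<Longrightarrow> S (s + t) x = S s (S t x)"
    and S_cont: "x \<in> X \<Longrightarrow> ((\<lambda>t. S t x) \<longlongrightarrow> x) (at_right 0)"
begin

text \<open>The graph of the generator.\<close>
definition gen :: "'z \<Rightarrow> 'z \<Rightarrow> bool" where
  "gen x y \<longleftrightarrow> x \<in> X \<and> y \<in> X \<and> ((\<lambda>t. (S t x - x) /\<^sub>R t) \<longlongrightarrow> y) (at_right 0)"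

lemma genX: assumes "gen x y" shows "x \<in> X" "y \<in> X"
  using assms by (auto simp: gen_def)

lemma S_X: "0 \<le> t \<Longrightarrow> x \<in> X \<Longrightarrow> S t x \<in> X"
  using S_pc pc_X by blast

lemma gen_unique: "gen x y \<Longrightarrow> gen x y' \<Longrightarrow> y = y'"
  unfolding gen_def using tendsto_unique trivial_limit_at_right_real by blast

lemma at_right_0_iff: "(\<forall>\<^sub>F t in at_right (0::real). Q t) \<longleftrightarrow> (\<exists>d>0. \<forall>t. 0 < t \<and> t < d \<longrightarrow> Q t)"
  by (auto simp: eventually_at_right_field)

lemma eventually_at_right_0_pos: "\<forall>\<^sub>F t in at_right (0::real). 0 < t"
  by (simp add: eventually_at_right_less)

lemma gen_add:
  assumes "gen x y" "gen x' y'" shows "gen (x + x') (y + y')"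
  unfolding gen_def
proof (intro conjI)
  show "x + x' \<in> X" "y + y' \<in> X" using assms by (auto dest: genX)
  have "((\<lambda>t. (S t x - x) /\<^sub>R t + (S t x' - x') /\<^sub>R t) \<longlongrightarrow> y + y') (at_right 0)"
    using assms unfolding gen_def by (intro tendsto_add) auto
  then show "((\<lambda>t. (S t (x + x') - (x + x')) /\<^sub>R t) \<longlongrightarrow> y + y') (at_right 0)"
  proof (rule Lim_transform_eventually)
    show "\<forall>\<^sub>F t in at_right 0. (S t x - x) /\<^sub>R t + (S t x' - x') /\<^sub>R t = (S t (x + x') - (x + x')) /\<^sub>R t"
      using eventually_at_right_0_pos
    proof eventually_elim
      case (elim t)
      then show ?case using assms genX by (simp add: pc_add [OF S_pc] algebra_simps)
    qed
  qed
qed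

lemma gen_scale:
  assumes "gen x y" shows "gen (c *\<^sub>R x) (c *\<^sub>R y)"
  unfolding gen_def
proof (intro conjI)
  show "c *\<^sub>R x \<in> X" "c *\<^sub>R y \<in> X" using assms by (auto dest: genX)
  have "((\<lambda>t. c *\<^sub>R ((S t x - x) /\<^sub>R t)) \<longlongrightarrow> c *\<^sub>R y) (at_right 0)"
    using assms unfolding gen_def by (intro tendsto_intros) auto
  then show "((\<lambda>t. (S t (c *\<^sub>R x) - (c *\<^sub>R x)) /\<^sub>R t) \<longlongrightarrow> c *\<^sub>R y) (at_right 0)"
  proof (rule Lim_transform_eventually)
    show "\<forall>\<^sub>F t in at_right 0. c *\<^sub>R ((S t x - x) /\<^sub>R t) = (S t (c *\<^sub>R x) - (c *\<^sub>R x)) /\<^sub>R t"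
      using eventually_at_right_0_pos
    proof eventually_elim
      case (elim t)
      then show ?case using assms genX by (simp add: pc_scale [OF S_pc] algebra_simps)
    qed
  qed
qed

lemma gen_diff: "gen x y \<Longrightarrow> gen x' y' \<Longrightarrow> gen (x - x') (y - y')"
  using gen_add [of x y "- x'" "- y'"] gen_scale [of x' y' "-1"] by simp

lemma gen_0: "gen 0 0"
  unfolding gen_def
proof (intro conjI)
  have "((\<lambda>t::real. 0::'z) \<longlongrightarrow> 0) (at_right 0)" by simp
  then show "((\<lambda>t. (S t 0 - 0) /\<^sub>R t) \<longlongrightarrow> 0) (at_right 0)"
  proof (rule Lim_transform_eventually)
    show "\<forall>\<^sub>F t in at_right 0. 0 = (S t 0 - 0) /\<^sub>R t"
      using eventually_at_right_0_pos
    proof eventually_elim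
      case (elim t)
      then show ?case using linear_on_X_0 [OF pc_linear [OF S_pc], of t] by simp
    qed
  qed
qed auto

lemma gen_commute:
  assumes g: "gen x y" and T: "pos_contr T" and comm: "\<And>t. 0 \<le> t \<Longrightarrow> S t (T x) = T (S t x)"
  shows "gen (T x) (T y)"
  unfolding gen_def
proof (intro conjI)
  show "T x \<in> X" "T y \<in> X" using genX [OF g] pc_X [OF T] by auto
  define f where "f t = (if t > 0 then (S t x - x) /\<^sub>R t else y)" for t
  have "(f \<longlongrightarrow> y) (at_right 0)"
  proof (rule Lim_transform_eventually)
    show "((\<lambda>t. (S t x - x) /\<^sub>R t) \<longlongrightarrow> y) (at_right 0)" using g by (simp add: gen_def)
    show "\<forall>\<^sub>F t in at_right 0. (S t x - x) /\<^sub>R t = f t"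
      using eventually_at_right_0_pos by eventually_elim (simp add: f_def)
  qed
  then have "((\<lambda>t. T (f t)) \<longlongrightarrow> T y) (at_right 0)"
    by (rule pc_tendsto [OF T]) (use genX [OF g] S_X in \<open>auto simp: f_def\<close>)
  then show "((\<lambda>t. (S t (T x) - T x) /\<^sub>R t) \<longlongrightarrow> T y) (at_right 0)"
  proof (rule Lim_transform_eventually)
    show "\<forall>\<^sub>F t in at_right 0. T (f t) = (S t (T x) - T x) /\<^sub>R t"
      using eventually_at_right_0_pos
    proof eventually_elim
      case (elim t)
      then show ?case
        using genX [OF g] S_X [of t x]
        by (simp add: f_def comm pc_scale [OF T] pc_diff [OF T])
    qed
  qed
qed

lemma gen_S:
  assumes g: "gen x y" and t: "0 \<le> t" shows "gen (S t x) (S t y)"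
proof (rule gen_commute [OF g S_pc [OF t]])
  fix s :: real assume "0 \<le> s"
  then show "S s (S t x) = S t (S s x)"
    using S_plus [of s t x] S_plus [of t s x] t genX [OF g] by (simp add: add.commute)
qed

text \<open>
  With \<open>u = l v - w \<ge> 0\<close> one has \<open>(1 + l t) v = S t v + t u + o(t)\<close>. Taking negative parts gives
  \<open>(1 + l t) \<parallel>v\<^sup>-\<parallel> \<le> \<parallel>v\<^sup>-\<parallel> + o(t)\<close>, and dividing by \<open>t\<close> gives \<open>v\<^sup>- = 0\<close>.
\<close>
lemma resolvent_positive:
  assumes g: "gen v w" and l: "0 < l" and u: "l *\<^sub>R v - w \<in> Pos"
  shows "v \<in> Pos"
proof (rule neg_mass_0_Pos)
  define u where "u = l *\<^sub>R v - w"
  note X = genX [OF g]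
  define e where "e t = w - (S t v - v) /\<^sub>R t" for t
  have bound: "l * neg_mass v \<le> norm (e t)" if t: "0 < t" for t
  proof -
    have eX: "e t \<in> X" using X S_X t by (auto simp: e_def)
    have "(1 + l * t) *\<^sub>R v = S t v + (t *\<^sub>R u + t *\<^sub>R e t)"
      using t by (simp add: u_def e_def algebra_simps)
    then have "neg_mass ((1 + l * t) *\<^sub>R v) = neg_mass (S t v + (t *\<^sub>R u + t *\<^sub>R e t))"
      by (rule arg_cong)
    moreover have "neg_mass (S t v + (t *\<^sub>R u + t *\<^sub>R e t))
        \<le> neg_mass (S t v) + neg_mass (t *\<^sub>R u + t *\<^sub>R e t)"
      using X S_X [of t] t u eX by (intro neg_mass_add) (auto simp: u_def)
    moreover have "neg_mass (t *\<^sub>R u + t *\<^sub>R e t) \<le> neg_mass (t *\<^sub>R u) + neg_mass (t *\<^sub>R e t)"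
      using X u eX by (intro neg_mass_add) (auto simp: u_def)
    moreover have "neg_mass (t *\<^sub>R u) = 0"
      using u t by (intro neg_mass_Pos Pos_scale) (auto simp: u_def)
    moreover have "neg_mass (t *\<^sub>R e t) \<le> t * norm (e t)"
      using neg_mass_scale [of t "e t"] neg_mass_le_norm [OF eX] t eX by simp
    moreover have "neg_mass (S t v) \<le> neg_mass v"
      using t by (intro neg_mass_pc S_pc X) simp
    moreover have "neg_mass ((1 + l * t) *\<^sub>R v) = (1 + l * t) * neg_mass v"
      using t l X by (intro neg_mass_scale) auto
    ultimately have "(1 + l * t) * neg_mass v \<le> neg_mass v + t * norm (e t)" by linarith
    then have "t * (l * neg_mass v) \<le> t * norm (e t)" by (simp add: algebra_simps)
    then show ?thesis using t by simp
  qed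
  have "((\<lambda>t. norm (e t)) \<longlongrightarrow> norm (w - w)) (at_right 0)"
    unfolding e_def using g by (intro tendsto_intros) (simp add: gen_def)
  then have "l * neg_mass v \<le> norm (w - w)"
    by (rule tendsto_lowerbound) (use eventually_at_right_0_pos bound in \<open>auto elim!: eventually_mono\<close>)
  then show "neg_mass v = 0"
    using l neg_mass_nonneg [OF X(1)] by (simp add: mult_le_0_iff)
qed (rule genX(1) [OF g])

lemma resolvent_unique:
  assumes "gen v w" "gen v' w'" "0 < l" "l *\<^sub>R v - w = l *\<^sub>R v' - w'"
  shows "v = v'"
proof -
  have "gen (v - v') (w - w')" "gen (v' - v) (w' - w)" using assms gen_diff by blast+
  moreover have "l *\<^sub>R (v - v') - (w - w') = 0" "l *\<^sub>R (v' - v) - (w' - w) = 0"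
    using assms(4) by (simp_all add: algebra_simps)
  ultimately have "v - v' \<in> Pos" "v' - v \<in> Pos"
    using resolvent_positive [OF _ assms(3)] Pos_0 by metis+
  then have "norm (v - v') + norm (v' - v) = 0" using norm_add_Pos [of "v - v'" "v' - v"] by simp
  then show ?thesis by (simp add: norm_minus_commute [of v' v])
qed

text \<open>
  \<open>w\<close> solves \<open>l w - (S h w - w) / h = u\<close>, the resolvent equation with the generator replaced by a
  difference quotient. This is a fixed point equation for a strict contraction, so it is solvable.
  The resolvent of the generator is the limit of the solutions for \<open>h = 2\<^sup>-\<^sup>n\<close>.
\<close>
definition discrete_resolvent :: "real \<Rightarrow> real \<Rightarrow> 'z \<Rightarrow> 'z \<Rightarrow> bool" where
  "discrete_resolvent l h u w \<longleftrightarrow> w \<in> X \<and> (1 + l * h) *\<^sub>R w = S h w + h *\<^sub>R u"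

lemma discrete_resolvent_exists:
  assumes "0 < l" "0 < h" "u \<in> X"
  shows "\<exists>w. discrete_resolvent l h u w"
proof -
  define c where "c = 1 / (1 + l * h)"
  have c: "0 < c" "c < 1" "(1 + l * h) * c = 1"
    using mult_pos_pos [OF assms(1,2)] by (auto simp: c_def field_simps)
  have "\<exists>!w. w \<in> X \<and> c *\<^sub>R (S h w + h *\<^sub>R u) = w"
  proof (rule Banach_fix [OF complete_X, where c = c])
    show "(\<lambda>w. c *\<^sub>R (S h w + h *\<^sub>R u)) ` X \<subseteq> X" using assms S_X by auto
    fix x y assume xy: "x \<in> X" "y \<in> X"
    have "dist (c *\<^sub>R (S h x + h *\<^sub>R u)) (c *\<^sub>R (S h y + h *\<^sub>R u)) = c * norm (S h (x - y))"
      using c xy assms pc_diff [OF S_pc, of h x y] by (simp add: dist_norm flip: scaleR_diff_right)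
    also have "\<dots> \<le> c * dist x y"
      using c xy assms pc_norm [OF S_pc, of h "x - y"] by (simp add: dist_norm)
    finally show "dist (c *\<^sub>R (S h x + h *\<^sub>R u)) (c *\<^sub>R (S h y + h *\<^sub>R u)) \<le> c * dist x y" .
  qed (use c in auto)
  then obtain w where w: "w \<in> X" "w = c *\<^sub>R (S h w + h *\<^sub>R u)" by metis
  have "(1 + l * h) *\<^sub>R w = (1 + l * h) *\<^sub>R (c *\<^sub>R (S h w + h *\<^sub>R u))" using w(2) by simp
  also have "\<dots> = S h w + h *\<^sub>R u" using c by simp
  finally show ?thesis using w unfolding discrete_resolvent_def by blast
qed

lemma discrete_resolvent_bound:
  assumes "0 < l" "0 < h" "u \<in> X" "discrete_resolvent l h u w"
  shows "l * norm w \<le> norm u"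
proof -
  have X: "w \<in> X" and eq: "(1 + l * h) *\<^sub>R w = S h w + h *\<^sub>R u"
    using assms(4) by (auto simp: discrete_resolvent_def)
  have "(1 + l * h) * norm w = norm ((1 + l * h) *\<^sub>R w)" using assms by simp
  also have "\<dots> \<le> norm (S h w) + h * norm u"
    unfolding eq using norm_triangle_ineq [of "S h w" "h *\<^sub>R u"] assms by simp
  also have "norm (S h w) \<le> norm w" using assms X by (intro pc_norm S_pc) auto
  finally have "h * (l * norm w) \<le> h * norm u" by (simp add: algebra_simps)
  then show ?thesis using assms by simp
qed

lemma discrete_resolvent_diff:
  assumes "0 < h" "discrete_resolvent l h u w" "discrete_resolvent l h u' w'"
  shows "discrete_resolvent l h (u - u') (w - w')"
  using assms pc_diff [OF S_pc, of h w w'] by (auto simp: discrete_resolvent_def algebra_simps)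

lemma discrete_resolvent_S:
  assumes "0 < h" "0 \<le> s" "u \<in> X" "discrete_resolvent l h u w"
  shows "discrete_resolvent l h (S s u) (S s w)"
proof -
  have X: "w \<in> X" and eq: "(1 + l * h) *\<^sub>R w = S h w + h *\<^sub>R u"
    using assms(4) by (auto simp: discrete_resolvent_def)
  have "(1 + l * h) *\<^sub>R S s w = S s (S h w + h *\<^sub>R u)"
    using pc_scale [OF S_pc, of s w "1 + l * h"] assms X eq by simp
  also have "\<dots> = S s (S h w) + h *\<^sub>R S s u"
    using assms X S_X [of h w] by (simp add: pc_add [OF S_pc] pc_scale [OF S_pc])
  also have "S s (S h w) = S h (S s w)"
    using S_plus [of s h w] S_plus [of h s w] assms X by (simp add: add.commute)
  finally show ?thesis using X S_X assms by (simp add: discrete_resolvent_def)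
qed

text \<open>
  Put \<open>y = l w - u\<close>, the difference quotient of \<open>w\<close> at step \<open>h\<close>. Then \<open>S (m h) w - w\<close> is the sum of
  the \<open>h S (j h) y\<close>, \<open>j < m\<close>, and \<open>S (j h) y - y\<close> is controlled by the oscillation of \<open>S s u\<close> alone, uniformly in \<open>h\<close>,
  because \<open>S s w - w\<close> solves the discrete equation for \<open>S s u - u\<close>.
\<close>
lemma discrete_resolvent_increment:
  assumes l: "0 < l" and h: "0 < h" and u: "u \<in> X" and w: "discrete_resolvent l h u w"
    and osc: "\<And>s. 0 \<le> s \<Longrightarrow> s \<le> t \<Longrightarrow> norm (S s u - u) \<le> e"
    and m: "real m * h \<le> t"
  shows "norm (S (m * h) w - w - (m * h) *\<^sub>R (l *\<^sub>R w - u)) \<le> (m * h) * (2 * e)"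
  using m
proof (induction m)
  case 0
  then show ?case using w by (simp add: S_0 discrete_resolvent_def)
next
  case (Suc m)
  have X: "w \<in> X" and eq: "(1 + l * h) *\<^sub>R w = S h w + h *\<^sub>R u"
    using w by (auto simp: discrete_resolvent_def)
  define y where "y = l *\<^sub>R w - u"
  define s where "s = real m * h"
  have yX: "y \<in> X" using X u by (auto simp: y_def)
  have s: "0 \<le> s" "s \<le> t" "real (Suc m) * h = s + h" using Suc.prems h by (auto simp: s_def algebra_simps)
  have "discrete_resolvent l h (S s u - u) (S s w - w)"
    using discrete_resolvent_diff [OF h discrete_resolvent_S [OF h s(1) u w] w] .
  then have "l * norm (S s w - w) \<le> norm (S s u - u)"
    using S_X s u by (intro discrete_resolvent_bound [OF l h]) auto
  then have "l * norm (S s w - w) \<le> e" using osc [OF s(1,2)] by simp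
  moreover have "S s y - y = l *\<^sub>R (S s w - w) - (S s u - u)"
    using X u s by (simp add: y_def pc_diff [OF S_pc] pc_scale [OF S_pc] algebra_simps)
  then have "norm (S s y - y) \<le> l * norm (S s w - w) + norm (S s u - u)"
    using norm_triangle_ineq4 [of "l *\<^sub>R (S s w - w)" "S s u - u"] l by simp
  ultimately have osc_y: "norm (S s y - y) \<le> 2 * e" using osc [OF s(1,2)] by simp
  have "S h w = w + h *\<^sub>R y" using eq by (simp add: y_def algebra_simps)
  then have "S (s + h) w = S s w + h *\<^sub>R S s y"
    using S_plus [of s h w] s h X yX by (simp add: pc_add [OF S_pc] pc_scale [OF S_pc])
  then have "S (s + h) w - w - (s + h) *\<^sub>R y = (S s w - w - s *\<^sub>R y) + h *\<^sub>R (S s y - y)"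
    by (simp add: algebra_simps)
  then have "norm (S (s + h) w - w - (s + h) *\<^sub>R y) \<le> norm (S s w - w - s *\<^sub>R y) + norm (h *\<^sub>R (S s y - y))"
    by (simp only: norm_triangle_ineq)
  also have "\<dots> = norm (S s w - w - s *\<^sub>R y) + h * norm (S s y - y)"
    using h by simp
  also have "\<dots> \<le> s * (2 * e) + h * (2 * e)"
    using Suc.IH osc_y h s by (intro add_mono) (auto simp: s_def y_def)
  finally show ?case unfolding s(3) y_def [symmetric] by (simp add: algebra_simps)
qed

text \<open>
  By the previous estimate the solution at step \<open>k\<close> solves the equation at step \<open>m k\<close> up to an error of
  \<open>2 e\<close>. So the solutions form a Cauchy sequence under refinement.
\<close>
lemma discrete_resolvent_refine:
  assumes l: "0 < l" and k: "0 < k" and m: "0 < m" and u: "u \<in> X"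
    and w: "discrete_resolvent l k u w" and w': "discrete_resolvent l (real m * k) u w'"
    and osc: "\<And>s. 0 \<le> s \<Longrightarrow> s \<le> real m * k \<Longrightarrow> norm (S s u - u) \<le> e"
  shows "norm (w - w') \<le> 2 * e / l"
proof -
  define h where "h = real m * k"
  have h: "0 < h" using k m by (simp add: h_def)
  have X: "w \<in> X" using w by (simp add: discrete_resolvent_def)
  define d where "d = S h w - w - h *\<^sub>R (l *\<^sub>R w - u)"
  have d: "norm d \<le> h * (2 * e)"
    unfolding d_def h_def by (rule discrete_resolvent_increment [OF l k u w osc]) auto
  have dX: "d \<in> X" using X u S_X h by (auto simp: d_def)
  have "discrete_resolvent l h (u - d /\<^sub>R h) w"
    using X h by (simp add: discrete_resolvent_def d_def algebra_simps)
  then have "discrete_resolvent l h ((u - d /\<^sub>R h) - u) (w - w')"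
    using w' unfolding h_def [symmetric] by (rule discrete_resolvent_diff [OF h])
  then have "l * norm (w - w') \<le> norm ((u - d /\<^sub>R h) - u)"
    using dX u by (intro discrete_resolvent_bound [OF l h]) auto
  also have "\<dots> = norm d / h" using h by (simp add: divide_inverse)
  also have "\<dots> \<le> 2 * e" using d h by (simp add: field_simps)
  finally show ?thesis using l by (simp add: field_simps)
qed

lemma S_osc:
  assumes "u \<in> X" "0 < e"
  shows "\<exists>d>0. \<forall>s. 0 \<le> s \<and> s < d \<longrightarrow> norm (S s u - u) \<le> e"
proof -
  have "\<forall>\<^sub>F s in at_right 0. dist (S s u) u < e"
    using S_cont [OF assms(1)] assms(2) by (rule tendstoD)
  then obtain d where "d > 0" "\<forall>s. 0 < s \<and> s < d \<longrightarrow> norm (S s u - u) < e"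
    by (auto simp: at_right_0_iff dist_norm)
  then show ?thesis using S_0 [OF assms(1)] assms(2)
    by (intro exI [of _ d]) (auto simp: order_le_less)
qed

text \<open>
  Approximating \<open>t\<close> from below, \<open>S t v - S (s n) v = S (s n) (S (t - s n) v - v)\<close>; hence continuity at
  \<open>0\<close> from the right suffices.
\<close>
lemma S_left_approx:
  assumes v: "v \<in> X" and wv: "w \<longlonglongrightarrow> v" "\<And>n. w n \<in> X"
    and t: "s \<longlonglongrightarrow> t" "\<And>n. 0 \<le> s n" "\<And>n. s n \<le> t"
  shows "(\<lambda>n. S (s n) (w n)) \<longlonglongrightarrow> S t v"
proof (rule LIMSEQ_I)
  fix e :: real assume e: "0 < e"
  obtain d where d: "d > 0" "\<And>r. 0 \<le> r \<Longrightarrow> r < d \<Longrightarrow> norm (S r v - v) \<le> e / 3"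
    using S_osc [OF v, of "e / 3"] e by auto
  have "\<forall>\<^sub>F n in sequentially. norm (w n - v) < e / 3"
    using tendstoD [OF wv(1), of "e / 3"] e by (simp add: dist_norm)
  moreover have "\<forall>\<^sub>F n in sequentially. dist (s n) t < d"
    using tendstoD [OF t(1)] d by simp
  ultimately have "\<forall>\<^sub>F n in sequentially. norm (S (s n) (w n) - S t v) < e"
  proof eventually_elim
    case (elim n)
    have r: "0 \<le> t - s n" "t - s n < d" using elim t(3) [of n] by (auto simp: dist_real_def)
    have "S t v = S (s n) (S (t - s n) v)"
      using S_plus [of "s n" "t - s n" v] t(2) [of n] r v by simp
    then have "S (s n) (w n) - S t v = S (s n) (w n - v) - S (s n) (S (t - s n) v - v)"
      using t(2) [of n] r wv v S_X by (simp add: pc_diff [OF S_pc])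
    then have "norm (S (s n) (w n) - S t v) \<le> norm (S (s n) (w n - v)) + norm (S (s n) (S (t - s n) v - v))"
      by (simp add: norm_triangle_ineq4)
    also have "\<dots> \<le> norm (w n - v) + norm (S (t - s n) v - v)"
      using t(2) [of n] r wv v S_X by (intro add_mono pc_norm S_pc) auto
    also have "\<dots> \<le> norm (w n - v) + e / 3"
      using d(2) [OF r] by simp
    also have "\<dots> < e" using elim e by simp
    finally show ?case .
  qed
  then show "\<exists>no. \<forall>n\<ge>no. norm (S (s n) (w n) - S t v) < e"
    by (simp add: eventually_sequentially)
qed

text \<open>
  The limit \<open>v\<close> of the dyadic solutions inherits the estimate of \<open>discrete_resolvent_increment\<close>
  at every time \<open>t\<close>, since \<open>t\<close> is a limit of multiples of \<open>2\<^sup>-\<^sup>n\<close> from below; it says that the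
  difference quotients of \<open>v\<close> converge to \<open>l v - u\<close>.
\<close>
lemma resolvent_exists:
  assumes l: "0 < l" and u: "u \<in> X"
  shows "\<exists>v. gen v (l *\<^sub>R v - u)"
proof -
  define h where "h n = (1/2 :: real) ^ n" for n
  have h: "0 < h n" for n by (simp add: h_def)
  have h0: "h \<longlonglongrightarrow> 0" unfolding h_def by (rule LIMSEQ_realpow_zero) auto
  obtain w where w: "\<And>n. discrete_resolvent l (h n) u (w n)"
    using discrete_resolvent_exists [OF l h u] by metis
  have wX: "w n \<in> X" for n using w by (simp add: discrete_resolvent_def)
  have "Cauchy w"
  proof (rule metric_CauchyI)
    fix e :: real assume e: "0 < e"
    obtain d where d: "d > 0" "\<And>s. 0 \<le> s \<Longrightarrow> s < d \<Longrightarrow> norm (S s u - u) \<le> e * l / 8"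
      using S_osc [OF u, of "e * l / 8"] e l by auto
    obtain n where n: "h n < d"
      using LIMSEQ_D [OF h0 d(1)] by (auto simp: h_def)
    have close: "norm (w m - w n) \<le> e / 4" if "m \<ge> n" for m
    proof -
      have hn: "real (2 ^ (m - n)) * h m = h n"
      proof -
        have "(2::real) ^ m = 2 ^ (m - n) * 2 ^ n" using that by (simp flip: power_add)
        then show ?thesis by (simp add: h_def power_one_over)
      qed
      have "norm (w m - w n) \<le> 2 * (e * l / 8) / l"
        by (rule discrete_resolvent_refine [OF l h _ u w, of "2 ^ (m - n)" m])
          (use w [of n] hn d n in auto)
      then show ?thesis using l by simp
    qed
    have "dist (w i) (w j) < e" if "i \<ge> n" "j \<ge> n" for i j
      using close [OF that(1)] close [OF that(2)] norm_triangle_ineq4 [of "w i - w n" "w j - w n"] e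
      by (simp add: dist_norm)
    then show "\<exists>M. \<forall>m\<ge>M. \<forall>n\<ge>M. dist (w m) (w n) < e" by blast
  qed
  then obtain v where v: "v \<in> X" "w \<longlonglongrightarrow> v"
    using complete_X wX unfolding complete_def by blast
  have est: "norm (S t v - v - t *\<^sub>R (l *\<^sub>R v - u)) \<le> t * (2 * e)"
    if t: "0 < t" and osc: "\<And>s. 0 \<le> s \<Longrightarrow> s \<le> t \<Longrightarrow> norm (S s u - u) \<le> e" for t e
  proof -
    define m where "m n = nat \<lfloor>t / h n\<rfloor>" for n
    define s where "s n = real (m n) * h n" for n
    have m: "real (m n) = of_int \<lfloor>t / h n\<rfloor>" for n
      using t h [of n] by (simp add: m_def)
    have s: "s n \<le> t" "0 \<le> s n" "t - h n \<le> s n" for n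
    proof -
      have "real (m n) \<le> t / h n" "t / h n - 1 \<le> real (m n)" unfolding m by linarith+
      then show "s n \<le> t" "t - h n \<le> s n" using h [of n] by (auto simp: s_def field_simps)
      show "0 \<le> s n" using h [of n] by (simp add: s_def)
    qed
    have "(\<lambda>n. t - h n) \<longlonglongrightarrow> t - 0" by (intro tendsto_intros h0)
    then have st: "s \<longlonglongrightarrow> t"
      by (intro tendsto_sandwich [of "\<lambda>n. t - h n" s _ "\<lambda>n. t"]) (use s in auto)
    have "(\<lambda>n. norm (S (s n) (w n) - w n - s n *\<^sub>R (l *\<^sub>R w n - u)))
        \<longlonglongrightarrow> norm (S t v - v - t *\<^sub>R (l *\<^sub>R v - u))"
      by (intro tendsto_intros S_left_approx v wX st s)
    moreover have "(\<lambda>n. s n * (2 * e)) \<longlonglongrightarrow> t * (2 * e)" by (intro tendsto_intros st)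
    moreover have "norm (S (s n) (w n) - w n - s n *\<^sub>R (l *\<^sub>R w n - u)) \<le> s n * (2 * e)" for n
      using discrete_resolvent_increment [OF l h u w osc, of t "m n"] s [of n]
      unfolding s_def by blast
    ultimately show ?thesis by (intro LIMSEQ_le) auto
  qed
  have "((\<lambda>t. (S t v - v) /\<^sub>R t) \<longlongrightarrow> l *\<^sub>R v - u) (at_right 0)"
  proof (rule tendstoI)
    fix e :: real assume e: "0 < e"
    obtain d where d: "d > 0" "\<And>s. 0 \<le> s \<Longrightarrow> s < d \<Longrightarrow> norm (S s u - u) \<le> e / 4"
      using S_osc [OF u, of "e / 4"] e by auto
    have "dist ((S t v - v) /\<^sub>R t) (l *\<^sub>R v - u) < e" if t: "0 < t" "t < d" for t
    proof -
      have "(S t v - v) /\<^sub>R t - (l *\<^sub>R v - u) = (S t v - v - t *\<^sub>R (l *\<^sub>R v - u)) /\<^sub>R t"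
        using t by (simp add: algebra_simps)
      then have "dist ((S t v - v) /\<^sub>R t) (l *\<^sub>R v - u) = norm (S t v - v - t *\<^sub>R (l *\<^sub>R v - u)) / t"
        using t by (simp add: dist_norm divide_inverse)
      also have "\<dots> \<le> e / 2"
        using est [of t "e / 4"] d t by (simp add: field_simps)
      finally show ?thesis using e by simp
    qed
    then show "\<forall>\<^sub>F t in at_right 0. dist ((S t v - v) /\<^sub>R t) (l *\<^sub>R v - u) < e"
      unfolding at_right_0_iff using d by blast
  qed
  then show ?thesis using v u unfolding gen_def by blast
qed

definition R :: "real \<Rightarrow> 'z \<Rightarrow> 'z" where
  "R l u = (SOME v. gen v (l *\<^sub>R v - u))"

lemma gen_R: "0 < l \<Longrightarrow> u \<in> X \<Longrightarrow> gen (R l u) (l *\<^sub>R R l u - u)"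
  unfolding R_def by (rule someI_ex) (rule resolvent_exists)

lemma R_eqI: "gen v w \<Longrightarrow> 0 < l \<Longrightarrow> l *\<^sub>R v - w = u \<Longrightarrow> R l u = v"
  by (rule resolvent_unique [OF gen_R]) (use genX in auto)

lemma R_X: "0 < l \<Longrightarrow> u \<in> X \<Longrightarrow> R l u \<in> X"
  using gen_R genX by blast

text \<open>Dissipativity, from \<open>(1 + l t) v = S t v + t u + o(t)\<close> and \<open>\<parallel>S t v\<parallel> \<le> \<parallel>v\<parallel>\<close>.\<close>
lemma norm_R:
  assumes l: "0 < l" and u: "u \<in> X"
  shows "l * norm (R l u) \<le> norm u"
proof -
  define v where "v = R l u"
  define w where "w = l *\<^sub>R v - u"
  have g: "gen v w" unfolding v_def w_def by (rule gen_R [OF l u])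
  note X = genX [OF g]
  define e where "e t = w - (S t v - v) /\<^sub>R t" for t
  have bound: "l * norm v \<le> norm u + norm (e t)" if t: "0 < t" for t
  proof -
    have "(1 + l * t) *\<^sub>R v = S t v + (t *\<^sub>R u + t *\<^sub>R e t)"
      using t by (simp add: w_def e_def algebra_simps)
    then have "norm ((1 + l * t) *\<^sub>R v) \<le> norm (S t v) + (norm (t *\<^sub>R u) + norm (t *\<^sub>R e t))"
      by (metis norm_triangle_ineq norm_triangle_le norm_triangle_mono order_refl)
    moreover have "norm (S t v) \<le> norm v" using t X by (intro pc_norm S_pc) auto
    moreover have "norm ((1 + l * t) *\<^sub>R v) = norm v + t * (l * norm v)"
      using t l by (simp add: distrib_right del: scaleR_left_distrib)
    ultimately have "t * (l * norm v) \<le> t * (norm u + norm (e t))"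
      using t by (simp add: algebra_simps)
    then show ?thesis using t by simp
  qed
  have "((\<lambda>t. norm u + norm (e t)) \<longlongrightarrow> norm u + norm (w - w)) (at_right 0)"
    unfolding e_def using g by (intro tendsto_intros) (simp add: gen_def)
  then have "l * norm v \<le> norm u + norm (w - w)"
    by (rule tendsto_lowerbound) (use eventually_at_right_0_pos bound in \<open>auto elim!: eventually_mono\<close>)
  then show ?thesis by (simp add: v_def)
qed

lemma R_Pos: "0 < l \<Longrightarrow> u \<in> Pos \<Longrightarrow> R l u \<in> Pos"
  by (rule resolvent_positive [OF gen_R]) auto

lemma linear_R: "0 < l \<Longrightarrow> linear_on_X (R l)"
  unfolding linear_on_X_def
proof (intro conjI ballI allI)
  fix x y c assume l: "0 < l" and xy: "x \<in> X" "y \<in> X"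
  show "R l (x + y) = R l x + R l y"
    by (rule R_eqI [OF gen_add [OF gen_R gen_R]]) (use l xy in \<open>auto simp: algebra_simps\<close>)
  show "R l (c *\<^sub>R x) = c *\<^sub>R R l x"
    by (rule R_eqI [OF gen_scale [OF gen_R]]) (use l xy in \<open>auto simp: algebra_simps\<close>)
qed

lemma R_gen: "gen v w \<Longrightarrow> 0 < l \<Longrightarrow> R l w = l *\<^sub>R R l v - v"
  by (rule R_eqI [OF gen_diff [OF gen_scale [OF gen_R]]]) (auto simp: genX algebra_simps)

lemma R_S: "0 < l \<Longrightarrow> 0 \<le> t \<Longrightarrow> u \<in> X \<Longrightarrow> R l (S t u) = S t (R l u)"
  by (rule R_eqI [OF gen_S [OF gen_R]])
    (simp_all add: pc_diff [OF S_pc] pc_scale [OF S_pc] R_X X_intros)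

lemma R_resolvent_identity:
  assumes "0 < l" "0 < k" "u \<in> X"
  shows "R l u - R k u = (k - l) *\<^sub>R R l (R k u)"
proof -
  have "R l ((k - l) *\<^sub>R R k u) = R l u - R k u"
    by (rule R_eqI [OF gen_diff [OF gen_R gen_R]]) (use assms in \<open>auto simp: algebra_simps\<close>)
  then show ?thesis
    using linear_on_X_scale [OF linear_R, of l "R k u"] R_X assms by simp
qed

text \<open>
  On the domain of the generator \<open>t \<mapsto> c (S t v)\<close> has derivative \<open>c (S t w) = 0\<close>. In place of a
  derivative the interval is cut into \<open>n\<close> pieces, each of which contributes \<open>o(1/n)\<close>. An arbitrary \<open>u\<close> is reduced to the domain by
  \<open>c u = c (R 1 u)\<close>, as \<open>R 1 u - u\<close> is in the range of the generator.
\<close>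
lemma invariant_functional:
  fixes c :: "'z \<Rightarrow> real"
  assumes lin: "linear_on_X c" and bd: "\<And>x. x \<in> X \<Longrightarrow> \<bar>c x\<bar> \<le> norm x"
    and ker: "\<And>v w. gen v w \<Longrightarrow> c w = 0" and t: "0 \<le> t" and u: "u \<in> X"
  shows "c (S t u) = c u"
proof -
  have dom: "c (S t v) = c v" if g: "gen v w" for v w
  proof (cases "t = 0")
    case False
    note X = genX [OF g]
    with t False have t: "0 < t" by simp
    have inc: "\<bar>c (S (real m * h) v) - c v\<bar> \<le> real m * h * norm ((S h v - v) /\<^sub>R h - w)"
      if h: "0 < h" for h m
    proof (induction m)
      case (Suc m)
      define s where "s = real m * h"
      have s: "0 \<le> s" using h by (simp add: s_def)
      define d where "d = (S h v - v) /\<^sub>R h - w"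
      have dX: "d \<in> X" using X S_X h by (auto simp: d_def)
      have "S h v = v + (h *\<^sub>R w + h *\<^sub>R d)" using h by (simp add: d_def algebra_simps)
      then have "S (s + h) v = S s v + (h *\<^sub>R S s w + h *\<^sub>R S s d)"
        using S_plus [of s h v] s h X dX by (simp add: pc_add [OF S_pc] pc_scale [OF S_pc])
      then have "c (S (s + h) v) = c (S s v) + h * c (S s w) + h * c (S s d)"
        using s X dX S_X by (simp add: linear_on_X_add [OF lin] linear_on_X_scale [OF lin])
      moreover have "c (S s w) = 0" using ker gen_S [OF g s] by blast
      then have "h * c (S s w) = 0" by simp
      moreover have "\<bar>c (S s d)\<bar> \<le> norm d"
        using bd [of "S s d"] pc_norm [OF S_pc [OF s] dX] S_X [OF s dX] by simp
      then have "\<bar>h * c (S s d)\<bar> \<le> h * norm d" using h by (simp add: abs_mult)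
      ultimately have "\<bar>c (S (s + h) v) - c v\<bar> \<le> \<bar>c (S s v) - c v\<bar> + h * norm d" by linarith
      also have "\<dots> \<le> s * norm d + h * norm d" using Suc.IH by (simp add: s_def d_def)
      finally show ?case using h unfolding d_def s_def by (simp add: algebra_simps)
    qed (simp add: S_0 X)
    have "(\<lambda>n. t / real (Suc n)) \<longlonglongrightarrow> 0"
      using LIMSEQ_Suc [OF lim_const_over_n [of t]] by simp
    then have "filterlim (\<lambda>n. t / real (Suc n)) (at_right 0) sequentially"
      using t by (auto simp: filterlim_at intro!: always_eventually)
    then have "(\<lambda>n. (S (t / real (Suc n)) v - v) /\<^sub>R (t / real (Suc n))) \<longlonglongrightarrow> w"
      using g filterlim_compose [of _ "nhds w" "at_right 0"] unfolding gen_def by blast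
    then have "(\<lambda>n. t * norm ((S (t / real (Suc n)) v - v) /\<^sub>R (t / real (Suc n)) - w)) \<longlonglongrightarrow> t * norm (w - w)"
      by (intro tendsto_intros)
    then have "\<bar>c (S t v) - c v\<bar> \<le> t * norm (w - w)"
    proof (rule LIMSEQ_le_const)
      have "\<bar>c (S t v) - c v\<bar> \<le> t * norm ((S (t / real (Suc n)) v - v) /\<^sub>R (t / real (Suc n)) - w)" for n
        using inc [of "t / real (Suc n)" "Suc n"] t by simp
      then show "\<exists>N. \<forall>n\<ge>N. \<bar>c (S t v) - c v\<bar> \<le> t * norm ((S (t / real (Suc n)) v - v) /\<^sub>R (t / real (Suc n)) - w)"
        by blast
    qed
    then show ?thesis by simp
  qed (simp add: S_0 genX [OF g])
  have cR: "c (R 1 x) = c x" if "x \<in> X" for x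
    using ker [OF gen_R [OF _ that, of 1]] linear_on_X_diff [OF lin R_X [OF _ that, of 1] that] by simp
  have "c (S t u) = c (S t (R 1 u))"
    using cR [of "S t u"] R_S [of 1 t u] S_X t u by simp
  also have "\<dots> = c (R 1 u)" by (rule dom [OF gen_R]) (use u in auto)
  finally show ?thesis using cR u by simp
qed

end

section \<open>The operator K\<close>

text \<open>The premises \<open>gen x y\<close> make \<open>B\<close> an operator on the domain of the generator.\<close>
locale perturbation = substochastic X Pos S
  for X Pos :: "'z::real_normed_vector set" and S :: "real \<Rightarrow> 'z \<Rightarrow> 'z" +
  fixes B :: "'z \<Rightarrow> 'z"
  assumes B_X: "gen x y \<Longrightarrow> B x \<in> X"
    and B_add: "gen x y \<Longrightarrow> gen x' y' \<Longrightarrow> B (x + x') = B x + B x'"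
    and B_scale: "gen x y \<Longrightarrow> B (c *\<^sub>R x) = c *\<^sub>R B x"
    and B_Pos: "gen x y \<Longrightarrow> x \<in> Pos \<Longrightarrow> B x \<in> Pos"
    and J_balance_Pos: "gen x y \<Longrightarrow> x \<in> Pos \<Longrightarrow> J (y + B x) = 0"
begin

lemma B_diff: "gen x y \<Longrightarrow> gen x' y' \<Longrightarrow> B (x - x') = B x - B x'"
  using B_add [of x y "(-1) *\<^sub>R x'" "(-1) *\<^sub>R y'"] gen_scale [of x' y' "-1"] B_scale [of x' y' "-1"]
  by simp

definition T :: "real \<Rightarrow> 'z \<Rightarrow> 'z" where
  "T l u = B (R l u)"

lemma linear_T: "0 < l \<Longrightarrow> linear_on_X (T l)"
  using linear_R [of l] B_add [OF gen_R gen_R] B_scale [OF gen_R]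
  by (simp add: linear_on_X_def T_def)

lemma T_X: "0 < l \<Longrightarrow> u \<in> X \<Longrightarrow> T l u \<in> X"
  unfolding T_def by (rule B_X [OF gen_R])

lemma T_Pos: "0 < l \<Longrightarrow> u \<in> Pos \<Longrightarrow> T l u \<in> Pos"
  unfolding T_def by (intro B_Pos [OF gen_R] R_Pos) auto

text \<open>The balance condition for \<open>R l u\<close>, whose image under the generator is \<open>l R l u - u\<close>.\<close>
lemma norm_T:
  assumes l: "0 < l" and u: "u \<in> Pos"
  shows "norm (T l u) = norm u - l * norm (R l u)"
proof -
  have X: "R l u \<in> X" "T l u \<in> X" "u \<in> X" using assms R_X T_X by auto
  have "0 = J (l *\<^sub>R R l u - u + T l u)"
    unfolding T_def using J_balance_Pos [OF gen_R [OF l]] R_Pos assms by auto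
  also have "\<dots> = l * J (R l u) - J u + J (T l u)"
    using X by (simp add: J_add J_diff J_scale)
  finally show ?thesis using assms by (simp add: J_Pos R_Pos T_Pos)
qed

lemma pc_T: "0 < l \<Longrightarrow> pos_contr (T l)"
  unfolding pos_contr_def by (simp add: linear_T T_Pos norm_T)

text \<open>
  Every element of the domain is a difference of positive elements of the domain: split
  \<open>x - y\<close>, whose image under \<open>R 1\<close> is \<open>x\<close>.
\<close>
lemma J_balance:
  assumes g: "gen x y"
  shows "J (y + B x) = 0"
proof -
  note X = genX [OF g]
  obtain p q where pq: "p \<in> Pos" "q \<in> Pos" "x - y = p - q"
    using Jordan [of "x - y"] X by auto
  have gp: "gen (R 1 r) (R 1 r - r)" if "r \<in> Pos" for r
    using gen_R [of 1 r] that by auto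
  have "R 1 (x - y) = x" using g by (rule R_eqI) auto
  then have x: "x = R 1 p - R 1 q"
    using linear_on_X_diff [OF linear_R, of 1 p q] pq by auto
  have "y = x - (p - q)" unfolding pq(3) [symmetric] by simp
  then have "y + B x = (R 1 p - p + B (R 1 p)) - (R 1 q - q + B (R 1 q))"
    using B_diff [OF gp gp, of p q] pq x by simp
  moreover have "J (R 1 r - r + B (R 1 r)) = 0" if "r \<in> Pos" for r
    using J_balance_Pos [OF gp [OF that]] R_Pos that by auto
  moreover have "R 1 r - r + B (R 1 r) \<in> X" if "r \<in> Pos" for r
    using gp [OF that] B_X genX that by (auto intro!: X_intros)
  ultimately show ?thesis using pq by (simp add: J_diff)
qed

lemma T_antimono:
  assumes l: "0 < l" "l \<le> k" and u: "u \<in> Pos"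
  shows "T l u - T k u \<in> Pos"
proof -
  have "R l u - R k u = (k - l) *\<^sub>R R l (R k u)"
    using assms by (intro R_resolvent_identity) auto
  also have "\<dots> \<in> Pos" using assms by (intro Pos_scale R_Pos) auto
  finally have "B (R l u - R k u) \<in> Pos"
    using assms by (intro B_Pos [OF gen_diff [OF gen_R gen_R]]) auto
  then show ?thesis unfolding T_def using assms B_diff [OF gen_R gen_R] by simp
qed

text \<open>
  Monotone convergence gives a limit along \<open>l = 1 / n\<close>; by monotonicity in \<open>l\<close> the whole family is
  squeezed between the members of this sequence and its limit.
\<close>
lemma T_convergent_Pos:
  assumes u: "u \<in> Pos"
  shows "\<exists>k\<in>X. ((\<lambda>l. T l u) \<longlongrightarrow> k) (at_right 0)"
proof -
  define f where "f n = T (1 / real (Suc n)) u" for n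
  have fP: "f n \<in> Pos" for n unfolding f_def using u by (intro T_Pos) auto
  have inc: "f (Suc n) - f n \<in> Pos" for n
    unfolding f_def using u by (intro T_antimono) (auto simp: frac_le)
  have "norm (f n) \<le> norm u" for n
    unfolding f_def using u by (intro pc_norm pc_T) auto
  then obtain k where k: "k \<in> X" "f \<longlonglongrightarrow> k"
    using monotone_convergence [of f] fP inc by blast
  have below: "k - T l u \<in> Pos" if l: "0 < l" for l
  proof -
    obtain n where n: "1 / real (Suc n) < l" using nat_approx_posE [OF l] by blast
    have "f n - T l u \<in> Pos" unfolding f_def using u l n by (intro T_antimono) auto
    moreover have "k - f n \<in> Pos" by (rule increasing_le_limit [OF inc k(2) k(1) PosX [OF fP]])
    ultimately show ?thesis by (rule Pos_trans)
  qed
  have "((\<lambda>l. T l u) \<longlongrightarrow> k) (at_right 0)"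
  proof (rule tendstoI)
    fix e :: real assume "0 < e"
    then obtain n where n: "norm (f n - k) < e" using LIMSEQ_D [OF k(2)] by blast
    have "dist (T l u) k < e" if l: "0 < l" "l < 1 / real (Suc n)" for l
    proof -
      have "norm (k - T l u) \<le> norm (k - f n)"
      proof (rule norm_mono_Pos)
        show "k - T l u \<in> Pos" using below l by simp
        have "T l u - f n \<in> Pos" unfolding f_def using l u by (intro T_antimono) auto
        then show "k - f n - (k - T l u) \<in> Pos" by simp
      qed
      then show ?thesis using n by (simp add: dist_norm norm_minus_commute)
    qed
    then show "\<forall>\<^sub>F l in at_right 0. dist (T l u) k < e"
      unfolding at_right_0_iff by (intro exI [of _ "1 / real (Suc n)"]) auto
  qed
  then show ?thesis using k by blast
qed

lemma eventually_at_right_0I: "(\<And>l. 0 < l \<Longrightarrow> Q l) \<Longrightarrow> \<forall>\<^sub>F l in at_right (0::real). Q l"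
  using eventually_at_right_0_pos by (rule eventually_mono)

lemma T_convergent:
  assumes u: "u \<in> X"
  shows "\<exists>k\<in>X. ((\<lambda>l. T l u) \<longlongrightarrow> k) (at_right 0)"
proof -
  obtain p q where pq: "p \<in> Pos" "q \<in> Pos" "u = p - q" using Jordan [OF u] by blast
  obtain k k' where k: "k \<in> X" "((\<lambda>l. T l p) \<longlongrightarrow> k) (at_right 0)"
      "k' \<in> X" "((\<lambda>l. T l q) \<longlongrightarrow> k') (at_right 0)"
    using T_convergent_Pos pq by metis
  have "((\<lambda>l. T l u) \<longlongrightarrow> k - k') (at_right 0)"
  proof (rule Lim_transform_eventually)
    show "((\<lambda>l. T l p - T l q) \<longlongrightarrow> k - k') (at_right 0)" by (intro tendsto_diff k)
    show "\<forall>\<^sub>F l in at_right 0. T l p - T l q = T l u"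
      by (rule eventually_at_right_0I) (use linear_on_X_diff [OF linear_T] pq in auto)
  qed
  then show ?thesis using k by blast
qed

definition K :: "'z \<Rightarrow> 'z" where
  "K u = Lim (at_right 0) (\<lambda>l. T l u)"

lemma K_lim: assumes "u \<in> X" shows "((\<lambda>l. T l u) \<longlongrightarrow> K u) (at_right 0)" "K u \<in> X"
proof -
  obtain k where k: "k \<in> X" "((\<lambda>l. T l u) \<longlongrightarrow> k) (at_right 0)"
    using T_convergent [OF assms] by blast
  have "K u = k" unfolding K_def by (rule tendsto_Lim [OF _ k(2)]) simp
  then show "((\<lambda>l. T l u) \<longlongrightarrow> K u) (at_right 0)" "K u \<in> X" using k by auto
qed

lemma K_eqI: "((\<lambda>l. T l u) \<longlongrightarrow> k) (at_right 0) \<Longrightarrow> K u = k"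
  unfolding K_def by (rule tendsto_Lim) simp_all

lemma linear_K: "linear_on_X K"
  unfolding linear_on_X_def
proof (intro conjI ballI allI)
  fix x y c assume xy: "x \<in> X" "y \<in> X"
  show "K (x + y) = K x + K y"
  proof (rule K_eqI, rule Lim_transform_eventually)
    show "((\<lambda>l. T l x + T l y) \<longlongrightarrow> K x + K y) (at_right 0)" by (intro tendsto_add K_lim xy)
    show "\<forall>\<^sub>F l in at_right 0. T l x + T l y = T l (x + y)"
      by (rule eventually_at_right_0I) (use linear_on_X_add [OF linear_T] xy in auto)
  qed
  show "K (c *\<^sub>R x) = c *\<^sub>R K x"
  proof (rule K_eqI, rule Lim_transform_eventually)
    show "((\<lambda>l. c *\<^sub>R T l x) \<longlongrightarrow> c *\<^sub>R K x) (at_right 0)" by (intro tendsto_scaleR tendsto_const K_lim xy)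
    show "\<forall>\<^sub>F l in at_right 0. c *\<^sub>R T l x = T l (c *\<^sub>R x)"
      by (rule eventually_at_right_0I) (use linear_on_X_scale [OF linear_T] xy in auto)
  qed
qed

lemma pc_K: "pos_contr K"
  unfolding pos_contr_def
proof (intro conjI ballI linear_K)
  fix p assume p: "p \<in> Pos"
  show "K p \<in> Pos"
    by (rule Pos_limit [OF K_lim(1) eventually_at_right_0I K_lim(2)]) (use p T_Pos in auto)
  show "norm (K p) \<le> norm p"
    by (rule tendsto_upperbound [OF tendsto_norm [OF K_lim(1)] eventually_at_right_0I])
      (use p pc_norm [OF pc_T] in auto)
qed

lemma T_le_K:
  assumes l: "0 < l" and u: "u \<in> Pos"
  shows "K u - T l u \<in> Pos"
proof (rule Pos_limit)
  show "((\<lambda>k. T k u - T l u) \<longlongrightarrow> K u - T l u) (at_right 0)"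
    using u by (intro tendsto_diff tendsto_const K_lim) auto
  show "\<forall>\<^sub>F k in at_right 0. T k u - T l u \<in> Pos"
    unfolding at_right_0_iff using l u by (intro exI [of _ l]) (auto intro: T_antimono)
  show "K u - T l u \<in> X" using l u by (intro X_intros K_lim T_X) auto
qed simp

text \<open>Indeed \<open>R l w = l R l v - v\<close>, so \<open>T l w = l T l v - B v\<close>, where \<open>T l v\<close> stays bounded.\<close>
lemma K_gen:
  assumes g: "gen v w"
  shows "K w = - B v"
proof (rule K_eqI, rule Lim_transform_eventually)
  note X = genX [OF g]
  have "((\<lambda>l. l *\<^sub>R T l v - B v) \<longlongrightarrow> 0 *\<^sub>R K v - B v) (at_right 0)"
    by (intro tendsto_intros K_lim X)
  then show "((\<lambda>l. l *\<^sub>R T l v - B v) \<longlongrightarrow> - B v) (at_right 0)" by simp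
  show "\<forall>\<^sub>F l in at_right 0. l *\<^sub>R T l v - B v = T l w"
  proof (rule eventually_at_right_0I)
    fix l :: real assume l: "0 < l"
    show "l *\<^sub>R T l v - B v = T l w"
      unfolding T_def R_gen [OF g l]
      using B_diff [OF gen_scale [OF gen_R [OF l X(1)]] g] B_scale [OF gen_R [OF l X(1)]] by simp
  qed
qed

section \<open>Stability of the unperturbed semigroup\<close>

text \<open>The functional \<open>J - J \<circ> K\<close> measures the mass lost by \<open>K\<close> and is invariant under \<open>S\<close>.\<close>
lemma stable_imp_K_isometric:
  assumes stable: "\<And>x. x \<in> X \<Longrightarrow> ((\<lambda>t. S t x) \<longlongrightarrow> 0) at_top" and p: "p \<in> Pos"
  shows "norm (K p) = norm p"
proof -
  define c where "c x = J x - J (K x)" for x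
  have KX: "K x \<in> X" if "x \<in> X" for x using K_lim that by blast
  have lin: "linear_on_X c"
    using linear_K KX by (simp add: c_def linear_on_X_def J_add J_scale algebra_simps)
  have bd: "\<bar>c x\<bar> \<le> norm x" if "x \<in> X" for x
  proof -
    have "norm (c x) \<le> norm x"
    proof (rule functional_bound [OF lin _ that])
      fix q assume q: "q \<in> Pos"
      show "norm (c q) \<le> norm q"
        using pc_Pos [OF pc_K q] pc_norm [OF pc_K, of q] q by (simp add: c_def J_Pos)
    qed
    then show ?thesis by simp
  qed
  have "c w = 0" if g: "gen v w" for v w
    using J_balance [OF g] K_gen [OF g] genX [OF g] B_X [OF g] J_minus
    by (simp add: c_def J_add)
  then have inv: "c (S t p) = c p" if "0 \<le> t" for t
    using invariant_functional [OF lin bd _ that, of p] p by blast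
  have pX: "p \<in> X" using p by blast
  have "((\<lambda>t. norm (S t p)) \<longlongrightarrow> 0) at_top"
    using tendsto_norm [OF stable [OF pX]] by simp
  moreover have "\<forall>\<^sub>F t in at_top. \<bar>c p\<bar> \<le> norm (S t p)"
    using eventually_ge_at_top [of 0]
    by eventually_elim (use inv bd S_X pX in metis)
  ultimately have "\<bar>c p\<bar> \<le> 0" by (rule tendsto_lowerbound) simp
  then show ?thesis using p pc_Pos [OF pc_K p] by (simp add: c_def J_Pos)
qed

lemma S_norm_antimono:
  assumes "0 \<le> s" "s \<le> t" "x \<in> X"
  shows "norm (S t x) \<le> norm (S s x)"
proof -
  have "S t x = S (t - s) (S s x)" using S_plus [of "t - s" s x] assms by simp
  then show ?thesis using pc_norm [OF S_pc, of "t - s" "S s x"] S_X assms by simp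
qed

lemma J_S_convergent:
  assumes "x \<in> X"
  shows "convergent (\<lambda>n. J (S (real n) x))"
proof -
  have pos: "convergent (\<lambda>n. J (S (real n) p))" if p: "p \<in> Pos" for p
  proof -
    have eq: "J (S (real n) p) = norm (S (real n) p)" for n
      using p by (intro J_Pos pc_Pos [OF S_pc]) auto
    have "decseq (\<lambda>n. norm (S (real n) p))"
      using p by (auto simp: decseq_def intro!: S_norm_antimono)
    then have "convergent (\<lambda>n. norm (S (real n) p))"
      by (rule decseq_convergent [where B = 0]) (auto simp: convergent_def)
    then show ?thesis by (simp add: eq)
  qed
  obtain p q where pq: "p \<in> Pos" "q \<in> Pos" "x = p - q" using Jordan [OF assms] by blast
  then have "J (S (real n) x) = J (S (real n) p) - J (S (real n) q)" for n
    using S_X pc_diff [OF S_pc, of "real n" p q] by (simp add: J_diff X_intros)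
  then show ?thesis using convergent_diff [OF pos pos] pq by simp
qed

text \<open>
  The mass \<open>L\<close> that survives under \<open>S\<close> vanishes on the range of the generator, so
  \<open>L p = l L (R l p) \<le> l \<parallel>R l p\<parallel> = \<parallel>p\<parallel> - \<parallel>T l p\<parallel>\<close>, which tends to the mass lost by \<open>K\<close>.
\<close>
lemma K_isometric_imp_stable:
  assumes iso: "\<And>p. p \<in> Pos \<Longrightarrow> norm (K p) = norm p" and x: "x \<in> X"
  shows "((\<lambda>t. S t x) \<longlongrightarrow> 0) at_top"
proof -
  define L where "L x = lim (\<lambda>n. J (S (real n) x))" for x
  have L: "(\<lambda>n. J (S (real n) x)) \<longlonglongrightarrow> L x" if "x \<in> X" for x
    unfolding L_def using J_S_convergent [OF that] by (simp add: convergent_LIMSEQ_iff)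
  have lin: "linear_on_X L"
    unfolding linear_on_X_def
  proof (intro conjI ballI allI)
    fix x y c assume xy: "x \<in> X" "y \<in> X"
    have "(\<lambda>n. J (S (real n) (x + y))) \<longlonglongrightarrow> L x + L y"
      using tendsto_add [OF L [OF xy(1)] L [OF xy(2)]] xy S_X by (simp add: pc_add [OF S_pc] J_add)
    then show "L (x + y) = L x + L y" using L xy LIMSEQ_unique by (metis X_intros(1))
    have "(\<lambda>n. J (S (real n) (c *\<^sub>R x))) \<longlonglongrightarrow> c * L x"
      using tendsto_mult [OF tendsto_const L [OF xy(1)]] xy S_X by (simp add: pc_scale [OF S_pc] J_scale)
    then show "L (c *\<^sub>R x) = c *\<^sub>R L x" using L xy LIMSEQ_unique by (metis X_intros(3) real_scaleR_def)
  qed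
  have bd: "\<bar>L x\<bar> \<le> norm x" if "x \<in> X" for x
  proof (rule LIMSEQ_le_const2 [OF tendsto_rabs [OF L [OF that]]])
    have "\<bar>J (S (real n) x)\<bar> \<le> norm x" for n
      using abs_J_le [OF S_X [OF _ that], of "real n"] pc_norm [OF S_pc _, of "real n" x] that by simp
    then show "\<exists>N. \<forall>n\<ge>N. \<bar>J (S (real n) x)\<bar> \<le> norm x" by blast
  qed
  \<comment> \<open>\<open>L\<close> is a limit over integer times; monotonicity in time makes it invariant under \<open>S h\<close> for small \<open>h\<close>.\<close>
  have L_S_Pos: "L (S h p) = L p" if p: "p \<in> Pos" and h: "0 \<le> h" "h \<le> 1" for h p
  proof (rule LIMSEQ_unique [OF L])
    show "S h p \<in> X" using S_X p h by auto
    have norm: "J (S t p) = norm (S t p)" if "0 \<le> t" for t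
      using J_Pos [OF pc_Pos [OF S_pc [OF that] p]] .
    have eq: "S (real n) (S h p) = S (real n + h) p" for n
      using S_plus [of "real n" h p] h p by auto
    show "(\<lambda>n. J (S (real n) (S h p))) \<longlonglongrightarrow> L p"
    proof (rule tendsto_sandwich)
      show "(\<lambda>n. J (S (real (Suc n)) p)) \<longlonglongrightarrow> L p" "(\<lambda>n. J (S (real n) p)) \<longlonglongrightarrow> L p"
        using LIMSEQ_Suc [OF L [of p]] L [of p] p by auto
      show "\<forall>\<^sub>F n in sequentially. J (S (real (Suc n)) p) \<le> J (S (real n) (S h p))"
        "\<forall>\<^sub>F n in sequentially. J (S (real n) (S h p)) \<le> J (S (real n) p)"
        unfolding eq using h p by (auto simp: norm intro!: always_eventually S_norm_antimono)
    qed
  qed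
  have L_S: "L (S h x) = L x" if x: "x \<in> X" and h: "0 \<le> h" "h \<le> 1" for h x
  proof -
    obtain p q where pq: "p \<in> Pos" "q \<in> Pos" "x = p - q" using Jordan [OF x] by blast
    have "L (S h x) = L (S h p - S h q)"
      using pq pc_diff [OF S_pc [OF h(1)], of p q] by auto
    also have "\<dots> = L (S h p) - L (S h q)"
      using pq by (intro linear_on_X_diff [OF lin] S_X h) auto
    also have "\<dots> = L x"
      using linear_on_X_diff [OF lin, of p q] pq h by (simp add: L_S_Pos X_intros)
    finally show ?thesis .
  qed
  have ker: "L w = 0" if g: "gen v w" for v w
  proof -
    note X = genX [OF g]
    have "((\<lambda>h. norm (w - (S h v - v) /\<^sub>R h)) \<longlongrightarrow> norm (w - w)) (at_right 0)"
      using g unfolding gen_def by (intro tendsto_intros) auto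
    then have "\<bar>L w\<bar> \<le> norm (w - w)"
    proof (rule tendsto_lowerbound)
      have "\<bar>L w\<bar> \<le> norm (w - (S h v - v) /\<^sub>R h)" if h: "0 < h" "h < 1" for h
      proof -
        have SX: "S h v \<in> X" using h X S_X by simp
        then have "L ((S h v - v) /\<^sub>R h) = (L (S h v) - L v) /\<^sub>R h"
          using X by (simp add: linear_on_X_scale [OF lin] linear_on_X_diff [OF lin])
        also have "\<dots> = 0" using L_S [of v h] h X by simp
        finally have "L (w - (S h v - v) /\<^sub>R h) = L w"
          using X SX by (simp add: linear_on_X_diff [OF lin])
        then show ?thesis using bd [of "w - (S h v - v) /\<^sub>R h"] X SX by simp
      qed
      then show "\<forall>\<^sub>F h in at_right 0. \<bar>L w\<bar> \<le> norm (w - (S h v - v) /\<^sub>R h)"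
        unfolding at_right_0_iff by (intro exI [of _ 1]) simp
    qed simp
    then show ?thesis by simp
  qed
  have L0: "L p = 0" if p: "p \<in> Pos" for p
  proof -
    have pX: "p \<in> X" using p by blast
    have bound: "L p \<le> norm p - norm (T l p)" if l: "0 < l" for l
    proof -
      have "L (l *\<^sub>R R l p - p) = 0" using ker [OF gen_R [OF l pX]] .
      then have "L p = l * L (R l p)"
        using R_X [OF l pX] pX by (simp add: linear_on_X_scale [OF lin] linear_on_X_diff [OF lin])
      also have "\<dots> \<le> l * norm (R l p)" using bd [OF R_X [OF l pX]] l by simp
      finally show ?thesis using norm_T [OF l p] by simp
    qed
    have "((\<lambda>l. norm p - norm (T l p)) \<longlongrightarrow> norm p - norm (K p)) (at_right 0)"
      by (intro tendsto_intros K_lim pX)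
    then have "L p \<le> norm p - norm (K p)"
      by (rule tendsto_lowerbound) (simp_all add: bound eventually_at_right_0I)
    moreover have "0 \<le> L p"
    proof (rule LIMSEQ_le_const [OF L [OF pX]])
      have "0 \<le> J (S (real n) p)" for n
        using J_Pos [OF pc_Pos [OF S_pc p, of "real n"]] by simp
      then show "\<exists>N. \<forall>n\<ge>N. 0 \<le> J (S (real n) p)" by blast
    qed
    ultimately show ?thesis using iso [OF p] by simp
  qed
  have S0: "(\<lambda>n. norm (S (real n) p)) \<longlonglongrightarrow> 0" if p: "p \<in> Pos" for p
  proof -
    have "J (S (real n) p) = norm (S (real n) p)" for n
      using J_Pos [OF pc_Pos [OF S_pc p, of "real n"]] by simp
    then show ?thesis using L [of p] L0 [OF p] p by auto
  qed
  obtain p q where pq: "p \<in> Pos" "q \<in> Pos" "x = p - q" using Jordan [OF x] by blast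
  have bound: "norm (S (real n) x) \<le> norm (S (real n) p) + norm (S (real n) q)" for n
    using pq pc_diff [OF S_pc, of "real n" p q] norm_triangle_ineq4 [of "S (real n) p"] by auto
  have "(\<lambda>n. norm (S (real n) p) + norm (S (real n) q)) \<longlonglongrightarrow> 0"
    using tendsto_add [OF S0 [OF pq(1)] S0 [OF pq(2)]] by simp
  then have lim: "(\<lambda>n. S (real n) x) \<longlonglongrightarrow> 0"
    by (rule Lim_null_comparison [OF always_eventually, rotated]) (simp add: bound)
  show ?thesis
  proof (rule tendstoI)
    fix e :: real assume "0 < e"
    then obtain n where n: "norm (S (real n) x) < e" using LIMSEQ_D [OF lim] by force
    have "dist (S t x) 0 < e" if "real n \<le> t" for t
      using S_norm_antimono [of "real n" t x] that x n by simp
    then show "\<forall>\<^sub>F t in at_top. dist (S t x) 0 < e"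
      unfolding eventually_at_top_linorder by blast
  qed
qed

section \<open>Mean ergodicity and the perturbed semigroup\<close>

lemma T_fixed_point:
  assumes l: "0 < l" and g: "g \<in> Pos" "T l g = g"
  shows "g = 0"
proof -
  have gX: "g \<in> X" using g by blast
  have "R l g = 0" using norm_T [OF l g(1)] g(2) l by simp
  then have "gen 0 (- g)" using gen_R [OF l gX] by simp
  then show ?thesis using gen_unique [OF gen_0] by fastforce
qed

text \<open>The powers decrease, so they converge, and the limit is a fixed point.\<close>
lemma T_power_null_of_supersolution:
  assumes l: "0 < l" and v: "v \<in> Pos" "v - T l v \<in> Pos"
  shows "(\<lambda>n. (T l ^^ n) v) \<longlonglongrightarrow> 0"
proof -
  note pc = pc_funpow [OF pc_T [OF l]]
  have vX: "v \<in> X" using v by blast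
  have P: "(T l ^^ n) v \<in> Pos" for n using pc_Pos [OF pc v(1)] .
  have dec: "(T l ^^ n) v - (T l ^^ Suc n) v \<in> Pos" for n
    using pc_Pos [OF pc v(2), of n] pc_diff [OF pc vX T_X [OF l vX], of n] by (simp add: funpow_swap1)
  define f where "f n = v - (T l ^^ n) v" for n
  have fP: "f n \<in> Pos" for n
  proof (induction n)
    case (Suc n)
    then show ?case using Pos_trans [OF dec] by (simp add: f_def)
  qed (simp add: f_def)
  have "norm (f n) \<le> norm v" for n
    by (rule norm_mono_Pos [OF fP]) (simp add: f_def P)
  moreover have "f (Suc n) - f n \<in> Pos" for n using dec [of n] by (simp add: f_def)
  ultimately obtain k where k: "k \<in> X" "f \<longlonglongrightarrow> k" using monotone_convergence [of f] fP by blast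
  define g where "g = v - k"
  have lim: "(\<lambda>n. (T l ^^ n) v) \<longlonglongrightarrow> g"
    using tendsto_diff [OF tendsto_const k(2), of v] by (simp add: f_def g_def)
  have gX: "g \<in> X" using k vX by (auto simp: g_def)
  have gP: "g \<in> Pos" by (rule Pos_limit [OF lim]) (use P gX in auto)
  have "(\<lambda>n. T l ((T l ^^ n) v)) \<longlonglongrightarrow> T l g"
    by (rule pc_tendsto [OF pc_T [OF l] lim _ gX]) (use P in blast)
  moreover have "(\<lambda>n. T l ((T l ^^ n) v)) \<longlonglongrightarrow> g" using LIMSEQ_Suc [OF lim] by simp
  ultimately have "T l g = g" by (rule LIMSEQ_unique)
  then show ?thesis using T_fixed_point [OF l gP] lim by simp
qed

lemma T_power_le_K_power:
  assumes l: "0 < l" and f: "f \<in> Pos"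
  shows "(K ^^ n) f - (T l ^^ n) f \<in> Pos"
proof (induction n)
  case (Suc n)
  have P: "(K ^^ n) f \<in> Pos" "(T l ^^ n) f \<in> Pos"
    using pc_Pos [OF pc_funpow [OF pc_K] f] pc_Pos [OF pc_funpow [OF pc_T [OF l]] f] by auto
  have "T l ((K ^^ n) f) - T l ((T l ^^ n) f) \<in> Pos"
    using T_Pos [OF l Suc.IH] pc_diff [OF pc_T [OF l], of "(K ^^ n) f" "(T l ^^ n) f"] P by auto
  then show ?case using Pos_trans [OF _ T_le_K [OF l P(1)]] by simp
qed simp

lemma mean_ergodic_limit_fixed:
  assumes x: "x \<in> X" and v: "v \<in> X" "(\<lambda>N. (1 / real N) *\<^sub>R (\<Sum>n<N. (K ^^ n) x)) \<longlonglongrightarrow> v"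
  shows "K v = v"
proof -
  note pc = pc_funpow [OF pc_K]
  define b where "b N = (1 / real N) *\<^sub>R (\<Sum>n<N. (K ^^ n) x)" for N
  have bX: "b N \<in> X" for N unfolding b_def using pc_X [OF pc x] by auto
  have sX: "(\<Sum>n<N. (K ^^ n) x) \<in> X" for N using pc_X [OF pc x] by auto
  have diff: "K (b N) - b N = (1 / real N) *\<^sub>R ((K ^^ N) x - x)" for N
  proof -
    have "K (\<Sum>n<N. (K ^^ n) x) = (\<Sum>n<N. (K ^^ Suc n) x)"
      using linear_on_X_sum [OF linear_K, of "{..<N}" "\<lambda>n. (K ^^ n) x"] pc_X [OF pc x] by simp
    moreover have "(\<Sum>n<N. (K ^^ Suc n) x) - (\<Sum>n<N. (K ^^ n) x) = (K ^^ N) x - x"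
      using sum_lessThan_telescope [of "\<lambda>n. (K ^^ n) x" N] by (simp add: sum_subtractf)
    ultimately show ?thesis
      unfolding b_def pc_scale [OF pc_K sX] by (simp flip: scaleR_diff_right)
  qed
  have "(\<lambda>N. K (b N) - b N) \<longlonglongrightarrow> K v - v"
    using v(2) unfolding b_def [symmetric] by (intro tendsto_diff pc_tendsto [OF pc_K]) (auto intro: bX v)
  moreover have "(\<lambda>N. K (b N) - b N) \<longlonglongrightarrow> 0"
  proof (rule Lim_null_comparison [OF always_eventually])
    show "\<forall>N. norm (K (b N) - b N) \<le> (2 * norm x) / real N"
    proof
      fix N
      have "norm ((K ^^ N) x - x) \<le> 2 * norm x"
        using norm_triangle_ineq4 [of "(K ^^ N) x" x] pc_norm [OF pc x, of N] by simp
      then show "norm (K (b N) - b N) \<le> (2 * norm x) / real N"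
        unfolding diff by (simp add: divide_right_mono)
    qed
    show "(\<lambda>N. (2 * norm x) / real N) \<longlonglongrightarrow> 0" by (rule lim_const_over_n)
  qed
  ultimately have "K v - v = 0" by (rule LIMSEQ_unique)
  then show ?thesis by simp
qed

text \<open>
  The means \<open>a N\<close> of \<open>T\<^sup>k f\<close> are below the means \<open>b N\<close> of \<open>K\<^sup>k f\<close>, and \<open>T\<^sup>n b N\<close> is close to
  \<open>T\<^sup>n v\<close>, which tends to \<open>0\<close>. As the norm of \<open>T\<^sup>k f\<close> decreases in \<open>k\<close> and norms of positive elements add up, the
  norm of \<open>T\<^sup>n a N\<close> is at least that of \<open>T\<^sup>n\<^sup>+\<^sup>N f\<close>.
\<close>
lemma mean_ergodic_imp_T_power_null:
  assumes l: "0 < l" and f: "f \<in> Pos"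
    and v: "v \<in> X" "(\<lambda>N. (1 / real N) *\<^sub>R (\<Sum>n<N. (K ^^ n) f)) \<longlonglongrightarrow> v"
  shows "(\<lambda>n. (T l ^^ n) f) \<longlonglongrightarrow> 0"
proof -
  note pc = pc_funpow [OF pc_T [OF l]]
  have fX: "f \<in> X" using f by blast
  define b where "b N = (1 / real N) *\<^sub>R (\<Sum>n<N. (K ^^ n) f)" for N
  define a where "a N = (1 / real N) *\<^sub>R (\<Sum>n<N. (T l ^^ n) f)" for N
  have KP: "(K ^^ n) f \<in> Pos" and TP: "(T l ^^ n) f \<in> Pos" for n
    using pc_Pos [OF pc_funpow [OF pc_K] f] pc_Pos [OF pc f] by auto
  have bP: "b N \<in> Pos" and aP: "a N \<in> Pos" for N
    unfolding a_def b_def using KP TP by (auto intro!: Pos_scale Pos_sum)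
  have baP: "b N - a N \<in> Pos" for N
    using T_power_le_K_power [OF l f]
    by (auto simp: a_def b_def simp flip: scaleR_diff_right sum_subtractf intro!: Pos_scale Pos_sum)
  have lim: "b \<longlonglongrightarrow> v" using v(2) unfolding b_def .
  have vP: "v \<in> Pos" by (rule Pos_limit [OF lim]) (use bP v in auto)
  have "K v = v" by (rule mean_ergodic_limit_fixed [OF fX v])
  then have Tv: "(\<lambda>n. (T l ^^ n) v) \<longlonglongrightarrow> 0"
    using T_power_null_of_supersolution [OF l vP] T_le_K [OF l vP] by simp
  show ?thesis
  proof (rule LIMSEQ_I)
    fix e :: real assume e: "0 < e"
    obtain n where n: "norm ((T l ^^ n) v) < e / 2" using LIMSEQ_D [OF Tv, of "e / 2"] e by force
    obtain N where N: "norm (b N - v) < e / 2" "0 < N"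
      using LIMSEQ_D [OF lim, of "e / 2"] e by (metis half_gt_zero less_Suc_eq_0_disj less_Suc_eq_le nat_le_linear order_le_less_trans zero_less_Suc)
    have mono: "norm ((T l ^^ j) f) \<le> norm ((T l ^^ i) f)" if "i \<le> j" for i j
    proof -
      have "(T l ^^ j) f = (T l ^^ (j - i)) ((T l ^^ i) f)"
        using that by (metis comp_apply funpow_add le_add_diff_inverse2)
      then show ?thesis using pc_norm [OF pc, of "(T l ^^ i) f"] TP [of i] by auto
    qed
    have "(T l ^^ n) (a N) = (1 / real N) *\<^sub>R (\<Sum>k<N. (T l ^^ (n + k)) f)"
    proof -
      have "(\<Sum>k<N. (T l ^^ k) f) \<in> X" using TP by auto
      then have "(T l ^^ n) (a N) = (1 / real N) *\<^sub>R (T l ^^ n) (\<Sum>k<N. (T l ^^ k) f)"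
        unfolding a_def by (rule pc_scale [OF pc])
      also have "(T l ^^ n) (\<Sum>k<N. (T l ^^ k) f) = (\<Sum>k<N. (T l ^^ (n + k)) f)"
        using linear_on_X_sum [OF pc_linear [OF pc], of "{..<N}" "\<lambda>k. (T l ^^ k) f" n] TP
        by (auto simp: funpow_add)
      finally show ?thesis .
    qed
    then have "norm ((T l ^^ n) (a N)) = (1 / real N) * (\<Sum>k<N. norm ((T l ^^ (n + k)) f))"
      using TP by (simp add: norm_sum_Pos)
    moreover have "real N * norm ((T l ^^ (n + N)) f) \<le> (\<Sum>k<N. norm ((T l ^^ (n + k)) f))"
      using sum_bounded_below [of "{..<N}" "norm ((T l ^^ (n + N)) f)" "\<lambda>k. norm ((T l ^^ (n + k)) f)"]
      by (simp add: mono)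
    ultimately have "real N * norm ((T l ^^ (n + N)) f) \<le> real N * norm ((T l ^^ n) (a N))"
      using N(2) by simp
    then have "norm ((T l ^^ (n + N)) f) \<le> norm ((T l ^^ n) (a N))"
      using N(2) by simp
    also have "\<dots> \<le> norm ((T l ^^ n) (b N))"
      using pc_Pos [OF pc aP] pc_Pos [OF pc baP] aP bP
      by (intro norm_mono_Pos) (auto simp: pc_diff [OF pc, symmetric] X_intros)
    also have "\<dots> \<le> norm ((T l ^^ n) (b N - v)) + norm ((T l ^^ n) v)"
      using norm_triangle_ineq [of "(T l ^^ n) (b N - v)" "(T l ^^ n) v"] bP [of N] vP
      by (simp add: pc_diff [OF pc] X_intros)
    also have "\<dots> \<le> norm (b N - v) + norm ((T l ^^ n) v)"
      using bP vP by (intro add_mono pc_norm [OF pc]) auto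
    also have "\<dots> < e" using n N by simp
    finally have *: "norm ((T l ^^ (n + N)) f) < e" .
    have "norm ((T l ^^ m) f - 0) < e" if "m \<ge> n + N" for m
      using mono [OF that] * by simp
    then show "\<exists>no. \<forall>m\<ge>no. norm ((T l ^^ m) f - 0) < e" by blast
  qed
qed

text \<open>
  The elements
  \<open>v = R 1 (f + \<dots> + T\<^sup>n\<^sup>-\<^sup>1 f)\<close> satisfy \<open>v - (A + B) v = f - T\<^sup>n f\<close>, so they identify the resolvent of the
  generator of \<open>Q\<close> at \<open>f - T\<^sup>n f\<close>, and the balance condition transfers to it.
\<close>
lemma mean_ergodic_imp_isometric:
  assumes erg: "\<And>x. x \<in> X \<Longrightarrow> \<exists>v\<in>X. (\<lambda>N. (1 / real N) *\<^sub>R (\<Sum>n<N. (K ^^ n) x)) \<longlonglongrightarrow> v"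
    and Q: "substochastic X Pos Q"
    and ext: "\<And>v w. gen v w \<Longrightarrow> substochastic.gen X Q v (w + B v)"
    and t: "0 \<le> t" and p: "p \<in> Pos"
  shows "norm (Q t p) = norm p"
proof -
  interpret Q: substochastic X Pos Q by (rule Q)
  have l: "(0::real) < 1" by simp
  note pc = pc_funpow [OF pc_T [OF l]]
  have J_R_Pos: "J (Q.R 1 f) = J f" if f: "f \<in> Pos" for f
  proof -
    have fX: "f \<in> X" using f by blast
    have TX: "(T 1 ^^ k) f \<in> X" for k using pc_X [OF pc fX] .
    define z where "z n = (T 1 ^^ n) f" for n
    have zX: "z n \<in> X" for n using TX by (simp add: z_def)
    have z0: "z \<longlonglongrightarrow> 0"
      unfolding z_def using mean_ergodic_imp_T_power_null [OF l f] erg [OF fX] by blast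
    have eq: "J (Q.R 1 f) - J (Q.R 1 (z n)) = J f - J (z n)" for n
    proof -
      define s where "s = (\<Sum>k<n. z k)"
      have sX: "s \<in> X" using zX by (auto simp: s_def)
      define v where "v = R 1 s"
      have g: "gen v (v - s)" using gen_R [OF l sX] by (simp add: v_def)
      have "B v = T 1 s" by (simp add: v_def T_def)
      also have "\<dots> = (\<Sum>k<n. z (Suc k))"
        unfolding s_def using linear_on_X_sum [OF linear_T [OF l], of "{..<n}" z] zX by (simp add: z_def)
      also have "\<dots> = s + (z n - f)"
        using sum_lessThan_telescope [of z n] by (simp add: s_def sum_subtractf z_def algebra_simps)
      finally have Bv: "v - s + B v = v - (f - z n)" by simp
      have "Q.gen v (v - (f - z n))" using ext [OF g] unfolding Bv .
      then have "Q.R 1 (f - z n) = v" by (rule Q.R_eqI) auto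
      moreover have "J (v - (f - z n)) = 0" using J_balance [OF g] unfolding Bv .
      ultimately have "J (Q.R 1 (f - z n)) = J (f - z n)"
        using genX [OF g] fX zX [of n] by (simp add: J_diff X_intros)
      then show ?thesis
        using linear_on_X_diff [OF Q.linear_R [OF l] fX zX [of n]] Q.R_X [OF l fX] Q.R_X [OF l zX [of n]] fX zX [of n]
        by (simp add: J_diff)
    qed
    have nz: "(\<lambda>n. norm (z n)) \<longlonglongrightarrow> 0" using z0 by (rule tendsto_norm_zero)
    have "norm (J (Q.R 1 (z n))) \<le> norm (z n)" for n
      using abs_J_le [OF Q.R_X [OF l zX [of n]]] Q.norm_R [OF l zX [of n]] by simp
    then have "(\<lambda>n. J (Q.R 1 (z n))) \<longlonglongrightarrow> 0"
      by (intro Lim_null_comparison [OF _ nz] always_eventually) blast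
    then have "(\<lambda>n. J (Q.R 1 f) - J (Q.R 1 (z n))) \<longlonglongrightarrow> J (Q.R 1 f) - 0"
      by (intro tendsto_diff tendsto_const)
    moreover have "norm (J (z n)) \<le> norm (z n)" for n
      using abs_J_le [OF zX] by simp
    then have "(\<lambda>n. J (z n)) \<longlonglongrightarrow> 0"
      by (intro Lim_null_comparison [OF _ nz] always_eventually) blast
    then have "(\<lambda>n. J f - J (z n)) \<longlonglongrightarrow> J f - 0"
      by (intro tendsto_diff tendsto_const)
    ultimately show ?thesis unfolding eq using LIMSEQ_unique by fastforce
  qed
  have "J y = 0" if g: "Q.gen x y" for x y
  proof -
    note X = Q.genX [OF g]
    obtain a b where ab: "a \<in> Pos" "b \<in> Pos" "x - y = a - b" using Jordan [of "x - y"] X by auto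
    have "Q.R 1 (x - y) = x" using g by (rule Q.R_eqI) auto
    then have "x = Q.R 1 a - Q.R 1 b"
      using linear_on_X_diff [OF Q.linear_R [OF l], of a b] ab by auto
    then have "J x = J a - J b" using ab Q.R_Pos by (simp add: J_diff J_R_Pos X_intros)
    also have "\<dots> = J (x - y)" using ab by (simp add: J_diff X_intros)
    also have "\<dots> = J x - J y" using X by (rule J_diff)
    finally show ?thesis by simp
  qed
  then have "J (Q t p) = J p"
    using Q.invariant_functional [OF linear_J abs_J_le _ t] p by blast
  then show ?thesis using p pc_Pos [OF Q.S_pc [OF t]] by (simp add: J_Pos)
qed

end

section \<open>The space of integrable functions as an L-space\<close>

text \<open>
  An almost everywhere class of integrable functions is represented by its pairings with measurable functions
  bounded by \<open>1\<close>, a bounded function on the set of all functions \<open>g\<close>. The index type carries the discrete topology, so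
  that every bounded function on it is continuous. Taking \<open>g = sgn u\<close> shows that
  the supremum norm of the pairings is the \<open>L\<^sup>1\<close> norm of \<open>u\<close>.
\<close>
type_synonym 'a L1_class = "('a \<Rightarrow> real) discrete \<Rightarrow>\<^sub>C real"

definition test_function :: "'a measure \<Rightarrow> ('a \<Rightarrow> real) \<Rightarrow> bool" where
  "test_function M g \<longleftrightarrow> g \<in> borel_measurable M \<and> (\<forall>x. \<bar>g x\<bar> \<le> 1)"

definition pairing :: "'a measure \<Rightarrow> ('a \<Rightarrow> real) \<Rightarrow> ('a \<Rightarrow> real) discrete \<Rightarrow> real" where
  "pairing M u g = (if test_function M (of_discrete g) then \<integral>x. of_discrete g x * u x \<partial>M else 0)"

definition cls :: "'a measure \<Rightarrow> ('a \<Rightarrow> real) \<Rightarrow> 'a L1_class" where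
  "cls M u = Bcontfun (pairing M u)"

lemma integrable_test:
  assumes "u \<in> L1 M" "test_function M g"
  shows "integrable M (\<lambda>x. g x * u x)"
proof (rule Bochner_Integration.integrable_bound [of M u])
  show "integrable M u" using assms by (simp add: L1_def)
  then show "(\<lambda>x. g x * u x) \<in> borel_measurable M"
    using assms(2) by (auto simp: test_function_def)
  show "AE x in M. norm (g x * u x) \<le> norm (u x)"
    using assms(2) by (auto simp: test_function_def abs_mult intro!: mult_left_le_one_le)
qed

lemma abs_pairing_le:
  assumes "u \<in> L1 M"
  shows "\<bar>pairing M u g\<bar> \<le> L1_norm M u"
proof (cases "test_function M (of_discrete g)")
  case True
  have "\<bar>\<integral>x. of_discrete g x * u x \<partial>M\<bar> \<le> (\<integral>x. \<bar>of_discrete g x * u x\<bar> \<partial>M)"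
    by (rule integral_abs_bound)
  also have "\<dots> \<le> (\<integral>x. \<bar>u x\<bar> \<partial>M)"
    using True assms
    by (intro integral_mono integrable_abs integrable_test) (auto simp: test_function_def L1_def abs_mult intro!: mult_left_le_one_le)
  finally show ?thesis using True by (simp add: pairing_def L1_norm_def)
qed (simp add: pairing_def L1_norm_def)

lemma apply_cls:
  assumes "u \<in> L1 M"
  shows "apply_bcontfun (cls M u) g = pairing M u g"
proof -
  have "pairing M u \<in> bcontfun"
  proof (rule bcontfun_normI)
    show "continuous_on UNIV (pairing M u)"
      by (simp add: continuous_on_open_vimage open_discrete)
    show "norm (pairing M u g) \<le> L1_norm M u" for g
      using abs_pairing_le [OF assms] by simp
  qed
  then show ?thesis by (simp add: cls_def Bcontfun_inverse)
qed

lemma L1_add: "u \<in> L1 M \<Longrightarrow> v \<in> L1 M \<Longrightarrow> (\<lambda>x. u x + v x) \<in> L1 M"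
  by (simp add: L1_def)

lemma L1_diff: "u \<in> L1 M \<Longrightarrow> v \<in> L1 M \<Longrightarrow> (\<lambda>x. u x - v x) \<in> L1 M"
  by (simp add: L1_def)

lemma L1_scale: "u \<in> L1 M \<Longrightarrow> (\<lambda>x. c * u x) \<in> L1 M"
  by (simp add: L1_def)

lemma cls_add:
  assumes "u \<in> L1 M" "v \<in> L1 M"
  shows "cls M (\<lambda>x. u x + v x) = cls M u + cls M v"
  by (rule bcontfun_eqI)
    (use assms in \<open>auto simp: apply_cls L1_add pairing_def distrib_left integrable_test\<close>)

lemma cls_scale:
  assumes "u \<in> L1 M"
  shows "cls M (\<lambda>x. c * u x) = c *\<^sub>R cls M u"
  by (rule bcontfun_eqI)
    (use assms in \<open>auto simp: apply_cls L1_scale pairing_def mult.left_commute [of _ c]\<close>)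

lemma cls_diff:
  assumes "u \<in> L1 M" "v \<in> L1 M"
  shows "cls M (\<lambda>x. u x - v x) = cls M u - cls M v"
  using cls_add [OF assms(1) L1_scale [OF assms(2), of "-1"]] cls_scale [OF assms(2), of "-1"] by simp

lemma cls_zero: "cls M (\<lambda>x. 0) = 0"
  using cls_scale [of "\<lambda>x. 0" M 0] by (simp add: L1_def)

lemma norm_cls:
  assumes "u \<in> L1 M"
  shows "norm (cls M u) = L1_norm M u"
proof (rule antisym)
  show "norm (cls M u) \<le> L1_norm M u"
    by (rule norm_bound) (use assms abs_pairing_le in \<open>simp add: apply_cls\<close>)
  have test: "test_function M (\<lambda>x. sgn (u x))"
    using assms by (auto simp: test_function_def L1_def sgn_real_def)
  have "L1_norm M u = pairing M u (discrete (\<lambda>x. sgn (u x)))"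
    using test by (simp add: pairing_def discrete_inverse L1_norm_def mult.commute flip: abs_sgn)
  also have "\<dots> \<le> norm (cls M u)"
    using norm_bounded [of "cls M u" "discrete (\<lambda>x. sgn (u x))"] assms by (simp add: apply_cls)
  finally show "L1_norm M u \<le> norm (cls M u)" .
qed

lemma cls_eq_iff:
  assumes "u \<in> L1 M" "v \<in> L1 M"
  shows "cls M u = cls M v \<longleftrightarrow> eq_ae M u v"
proof -
  have "cls M u = cls M v \<longleftrightarrow> norm (cls M (\<lambda>x. u x - v x)) = 0"
    using assms by (simp add: cls_diff)
  also have "\<dots> \<longleftrightarrow> (\<integral>x. \<bar>u x - v x\<bar> \<partial>M) = 0"
    using norm_cls [OF L1_diff [OF assms]] by (simp add: L1_norm_def)
  also have "\<dots> \<longleftrightarrow> eq_ae M u v"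
    using assms by (subst integral_nonneg_eq_0_iff_AE) (auto simp: L1_def eq_ae_def)
  finally show ?thesis .
qed

lemma L1_tendsto_iff:
  "L1_tendsto M f v F \<longleftrightarrow>
    v \<in> L1 M \<and> (\<forall>\<^sub>F i in F. f i \<in> L1 M) \<and> ((\<lambda>i. cls M (f i)) \<longlongrightarrow> cls M v) F"
proof -
  have "((\<lambda>i. L1_norm M (\<lambda>x. f i x - v x)) \<longlongrightarrow> 0) F \<longleftrightarrow> ((\<lambda>i. cls M (f i)) \<longlongrightarrow> cls M v) F"
    if v: "v \<in> L1 M" and f: "\<forall>\<^sub>F i in F. f i \<in> L1 M"
  proof -
    have "\<forall>\<^sub>F i in F. L1_norm M (\<lambda>x. f i x - v x) = norm (cls M (f i) - cls M v)"
      using f by eventually_elim (use v in \<open>simp add: cls_diff [symmetric] norm_cls L1_diff\<close>)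
    then show ?thesis
      by (subst tendsto_cong) (auto simp: tendsto_norm_zero_iff LIM_zero_iff)
  qed
  then show ?thesis unfolding L1_tendsto_def by blast
qed

definition L1_classes :: "'a measure \<Rightarrow> 'a L1_class set" where
  "L1_classes M = cls M ` L1 M"

definition pos_classes :: "'a measure \<Rightarrow> 'a L1_class set" where
  "pos_classes M = cls M ` pos_cone M (L1 M)"

lemma L1_norm_nonneg_fun:
  assumes "u \<in> L1 M" "AE x in M. 0 \<le> u x"
  shows "L1_norm M u = (\<integral>x. u x \<partial>M)"
  unfolding L1_norm_def using assms by (intro integral_cong_AE) (auto simp: L1_def)

lemma cls_pos_iff:
  assumes "u \<in> L1 M"
  shows "cls M u \<in> pos_classes M \<longleftrightarrow> (AE x in M. 0 \<le> u x)"
proof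
  assume "cls M u \<in> pos_classes M"
  then obtain w where w: "w \<in> L1 M" "AE x in M. 0 \<le> w x" "cls M u = cls M w"
    by (auto simp: pos_classes_def pos_cone_def le_ae_def)
  then have "AE x in M. u x = w x" using cls_eq_iff [OF assms w(1)] by (simp add: eq_ae_def)
  then show "AE x in M. 0 \<le> u x" using w(2) by eventually_elim simp
qed (use assms in \<open>auto simp: pos_classes_def pos_cone_def le_ae_def\<close>)

text \<open>
  The supremum has finite integral, hence is finite almost everywhere and integrable; it then dominates the
  differences \<open>\<bar>u n - v\<bar>\<close>.
\<close>
lemma L1_monotone_convergence:
  assumes L1: "\<And>n. u n \<in> L1 M" and pos: "\<And>n. AE x in M. 0 \<le> u n x"
    and mono: "\<And>n. AE x in M. u n x \<le> u (Suc n) x" and bd: "\<And>n. (\<integral>x. u n x \<partial>M) \<le> c"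
  shows "\<exists>v\<in>L1 M. (\<lambda>n. cls M (u n)) \<longlonglongrightarrow> cls M v"
proof -
  have int: "integrable M (u n)" for n using L1 by (simp add: L1_def)
  then have meas [measurable]: "u n \<in> borel_measurable M" for n by blast
  define s where "s x = (SUP n. ennreal (u n x))" for x
  have [measurable]: "s \<in> borel_measurable M" unfolding s_def by measurable
  have "(\<integral>\<^sup>+x. s x \<partial>M) = (SUP n. \<integral>\<^sup>+x. ennreal (u n x) \<partial>M)"
    unfolding s_def
  proof (rule nn_integral_monotone_convergence_SUP_AE)
    show "AE x in M. ennreal (u n x) \<le> ennreal (u (Suc n) x)" for n
      using mono [of n] by eventually_elim (rule ennreal_leI)
  qed simp
  also have "\<dots> \<le> ennreal c"
    using nn_integral_eq_integral [OF int pos] bd by (auto intro!: SUP_least ennreal_leI)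
  finally have sle: "(\<integral>\<^sup>+x. s x \<partial>M) \<le> ennreal c" .
  then have fin: "AE x in M. s x \<noteq> \<infinity>"
    by (intro nn_integral_PInf_AE) (auto simp: top_unique)
  define v where "v x = enn2real (s x)" for x
  have [measurable]: "v \<in> borel_measurable M" unfolding v_def by measurable
  have all: "AE x in M. (\<forall>n. 0 \<le> u n x \<and> u n x \<le> u (Suc n) x) \<and> s x \<noteq> \<infinity>"
    using pos mono fin by (simp add: AE_all_countable)
  have props: "AE x in M. (\<forall>n. 0 \<le> u n x \<and> u n x \<le> v x) \<and> (\<lambda>n. u n x) \<longlonglongrightarrow> v x"
    using all
  proof eventually_elim
    case (elim x)
    have sv: "s x = ennreal (v x)" using elim by (simp add: v_def ennreal_enn2real less_top)
    have v0: "0 \<le> v x" by (simp add: v_def)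
    have "incseq (\<lambda>n. ennreal (u n x))" using elim by (intro incseq_SucI ennreal_leI) auto
    then have "(\<lambda>n. ennreal (u n x)) \<longlonglongrightarrow> s x" unfolding s_def by (rule LIMSEQ_SUP)
    then have "(\<lambda>n. u n x) \<longlonglongrightarrow> v x"
      unfolding sv using elim v0 by (subst (asm) tendsto_ennreal_iff) auto
    moreover have "ennreal (u n x) \<le> ennreal (v x)" for n
      unfolding sv [symmetric] s_def by (rule SUP_upper) simp
    then have "u n x \<le> v x" for n using v0 by (simp add: ennreal_le_iff)
    ultimately show ?case using elim by blast
  qed
  have vint: "integrable M v"
  proof (rule integrableI_bounded)
    have "(\<integral>\<^sup>+x. ennreal (norm (v x)) \<partial>M) = (\<integral>\<^sup>+x. s x \<partial>M)"
      using fin by (intro nn_integral_cong_AE) (auto elim!: eventually_mono simp: v_def ennreal_enn2real less_top)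
    also have "\<dots> < \<infinity>" using sle by (simp add: order.strict_trans1)
    finally show "(\<integral>\<^sup>+x. ennreal (norm (v x)) \<partial>M) < \<infinity>" .
  qed simp
  then have vL1: "v \<in> L1 M" by (simp add: L1_def)
  have "(\<lambda>n. \<integral>x. \<bar>u n x - v x\<bar> \<partial>M) \<longlonglongrightarrow> (\<integral>x. 0 \<partial>M)"
  proof (rule integral_dominated_convergence [where w = v])
    show "AE x in M. (\<lambda>n. \<bar>u n x - v x\<bar>) \<longlonglongrightarrow> 0"
      using props
    proof eventually_elim
      case (elim x)
      then show ?case using tendsto_rabs_zero [OF LIM_zero, of "\<lambda>n. u n x" "v x" sequentially] by simp
    qed
    show "AE x in M. norm \<bar>u n x - v x\<bar> \<le> v x" for n
      using props
    proof eventually_elim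
      case (elim x)
      then have "0 \<le> u n x" "u n x \<le> v x" by auto
      then show ?case by simp
    qed
  qed (use vint in auto)
  then have "L1_tendsto M u v sequentially"
    using L1 vL1 by (simp add: L1_tendsto_def L1_norm_def)
  then show ?thesis using vL1 unfolding L1_tendsto_iff by blast
qed

lemma L_space_L1: "L_space (L1_classes M) (pos_classes M)"
proof
  show "subspace (L1_classes M)"
    unfolding subspace_def
  proof (intro conjI ballI allI)
    show "0 \<in> L1_classes M"
      unfolding L1_classes_def by (rule image_eqI [where x = "\<lambda>x. 0"]) (simp_all add: L1_def cls_zero)
    fix x y c assume "x \<in> L1_classes M" "y \<in> L1_classes M"
    then obtain u v where uv: "u \<in> L1 M" "x = cls M u" "v \<in> L1 M" "y = cls M v"
      by (auto simp: L1_classes_def)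
    show "x + y \<in> L1_classes M"
      unfolding L1_classes_def uv(2,4) cls_add [OF uv(1,3), symmetric] by (intro imageI L1_add uv)
    show "c *\<^sub>R x \<in> L1_classes M"
      unfolding L1_classes_def uv(2) cls_scale [OF uv(1), symmetric] by (intro imageI L1_scale uv)
  qed
  show "pos_classes M \<subseteq> L1_classes M" by (auto simp: pos_classes_def L1_classes_def pos_cone_def)
next
  fix x y assume "x \<in> pos_classes M" "y \<in> pos_classes M"
  then obtain u v where uv: "u \<in> L1 M" "x = cls M u" "v \<in> L1 M" "y = cls M v"
      "AE x in M. 0 \<le> u x" "AE x in M. 0 \<le> v x"
    by (auto simp: pos_classes_def pos_cone_def le_ae_def)
  have sum: "x + y = cls M (\<lambda>x. u x + v x)" using uv by (simp add: cls_add)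
  have pos: "AE x in M. 0 \<le> u x + v x" using uv(5,6) by eventually_elim simp
  show "x + y \<in> pos_classes M" unfolding sum using uv pos by (simp add: cls_pos_iff L1_add)
  have "norm (x + y) = (\<integral>x. u x + v x \<partial>M)"
    unfolding sum using uv pos by (simp add: norm_cls L1_add L1_norm_nonneg_fun)
  also have "\<dots> = norm x + norm y"
    using uv by (simp add: norm_cls L1_norm_nonneg_fun L1_def)
  finally show "norm (x + y) = norm x + norm y" .
next
  fix x and c :: real assume c: "0 \<le> c" and "x \<in> pos_classes M"
  then obtain u where u: "u \<in> L1 M" "x = cls M u" "AE x in M. 0 \<le> u x"
    by (auto simp: pos_classes_def pos_cone_def le_ae_def)
  have "AE x in M. 0 \<le> c * u x" using u(3) by eventually_elim (simp add: c)
  then show "c *\<^sub>R x \<in> pos_classes M"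
    unfolding u(2) cls_scale [OF u(1), symmetric] using u by (simp add: cls_pos_iff L1_scale)
next
  fix x assume "x \<in> L1_classes M"
  then obtain u where u: "u \<in> L1 M" "x = cls M u" by (auto simp: L1_classes_def)
  define p where "p = (\<lambda>x. max 0 (u x))"
  define q where "q = (\<lambda>x. max 0 (- u x))"
  have int: "integrable M u" using u by (simp add: L1_def)
  have pq: "p \<in> L1 M" "q \<in> L1 M" using int by (auto simp: L1_def p_def q_def)
  have "x = cls M p - cls M q"
    unfolding u(2) cls_diff [OF pq, symmetric] by (rule arg_cong [where f = "cls M"]) (auto simp: p_def q_def)
  moreover have "norm x = norm (cls M p) + norm (cls M q)"
  proof -
    have "norm x = (\<integral>x. p x + q x \<partial>M)"
      unfolding u(2) norm_cls [OF u(1)] L1_norm_def by (rule arg_cong [where f = "integral\<^sup>L M"]) (auto simp: p_def q_def)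
    also have "\<dots> = (\<integral>x. p x \<partial>M) + (\<integral>x. q x \<partial>M)" using pq by (simp add: L1_def)
    also have "\<dots> = norm (cls M p) + norm (cls M q)"
      using pq by (simp add: norm_cls L1_norm_nonneg_fun p_def q_def)
    finally show ?thesis .
  qed
  moreover have "cls M p \<in> pos_classes M" "cls M q \<in> pos_classes M"
    using pq by (auto simp: cls_pos_iff p_def q_def)
  ultimately show "\<exists>p\<in>pos_classes M. \<exists>q\<in>pos_classes M. x = p - q \<and> norm x = norm p + norm q" by blast
next
  fix f :: "nat \<Rightarrow> 'a L1_class" and c :: real
  assume f: "\<And>n. f n \<in> pos_classes M" and inc: "\<And>n. f (Suc n) - f n \<in> pos_classes M"
    and bd: "\<And>n. norm (f n) \<le> c"
  have "\<forall>n. \<exists>u. u \<in> L1 M \<and> (AE x in M. 0 \<le> u x) \<and> f n = cls M u"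
    using f by (auto simp: pos_classes_def pos_cone_def le_ae_def)
  then obtain u where u: "\<And>n. u n \<in> L1 M" "\<And>n. AE x in M. 0 \<le> u n x" "\<And>n. f n = cls M (u n)"
    by metis
  have "\<exists>v\<in>L1 M. (\<lambda>n. cls M (u n)) \<longlonglongrightarrow> cls M v"
  proof (rule L1_monotone_convergence [OF u(1,2)])
    fix n
    have "cls M (\<lambda>x. u (Suc n) x - u n x) \<in> pos_classes M"
      using inc [of n] u by (simp add: cls_diff)
    then have "AE x in M. 0 \<le> u (Suc n) x - u n x" using u by (simp add: cls_pos_iff L1_diff)
    then show "AE x in M. u n x \<le> u (Suc n) x" by eventually_elim simp
    show "(\<integral>x. u n x \<partial>M) \<le> c"
      using bd [of n] u by (simp add: norm_cls L1_norm_nonneg_fun)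
  qed
  moreover have "f = (\<lambda>n. cls M (u n))" using u(3) by (rule ext)
  ultimately show "\<exists>l\<in>L1_classes M. f \<longlonglongrightarrow> l" by (auto simp: L1_classes_def)
qed

lemma J_cls:
  assumes "u \<in> L1 M"
  shows "L_space.J (pos_classes M) (cls M u) = (\<integral>x. u x \<partial>M)"
proof -
  interpret L_space "L1_classes M" "pos_classes M" by (rule L_space_L1)
  define p where "p = (\<lambda>x. max 0 (u x))"
  define q where "q = (\<lambda>x. max 0 (- u x))"
  have pq: "p \<in> L1 M" "q \<in> L1 M" using assms by (auto simp: L1_def p_def q_def)
  have eq: "u = (\<lambda>x. p x - q x)" by (auto simp: p_def q_def)
  have "J (cls M u) = J (cls M p - cls M q)" using cls_diff [OF pq] eq by simp
  also have "\<dots> = norm (cls M p) - norm (cls M q)"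
    using pq by (intro J_diff_Pos) (auto simp: cls_pos_iff p_def q_def)
  also have "\<dots> = (\<integral>x. p x \<partial>M) - (\<integral>x. q x \<partial>M)"
    using pq by (simp add: norm_cls L1_norm_nonneg_fun p_def q_def)
  also have "\<dots> = (\<integral>x. u x \<partial>M)" unfolding eq using pq by (simp add: L1_def)
  finally show ?thesis .
qed

text \<open>
  The operator on classes induced by an operator on functions, by choice of a representative. The
  congruence property of a linear operator makes the choice irrelevant on its domain.
\<close>
definition lift :: "'a measure \<Rightarrow> (('a \<Rightarrow> real) \<Rightarrow> 'a \<Rightarrow> real) \<Rightarrow> 'a L1_class \<Rightarrow> 'a L1_class" where
  "lift M T z = cls M (T (SOME u. u \<in> L1 M \<and> cls M u = z))"

lemma lift_cls:
  assumes T: "linear_operator M D T" and u: "u \<in> D"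
  shows "lift M T (cls M u) = cls M (T u)"
proof -
  have sub: "L1_subspace M D" using T by (rule linear_operator.subspace)
  then have uL1: "u \<in> L1 M" using u by (auto simp: L1_subspace_def)
  define r where "r = (SOME v. v \<in> L1 M \<and> cls M v = cls M u)"
  have r: "r \<in> L1 M" "cls M r = cls M u"
    unfolding r_def using someI [of "\<lambda>v. v \<in> L1 M \<and> cls M v = cls M u" u] uL1 by auto
  then have ae: "eq_ae M u r" using cls_eq_iff [OF uL1 r(1)] by simp
  then have rD: "r \<in> D" using sub u r by (auto simp: L1_subspace_def)
  have "eq_ae M (T u) (T r)" using linear_operator.cong [OF T u rD ae] .
  then have "cls M (T u) = cls M (T r)"
    using cls_eq_iff linear_operator.into_L1 [OF T] u rD by blast
  then show ?thesis by (simp add: lift_def r_def)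
qed

lemma lift_cls_add:
  assumes T: "linear_operator M D T" and u: "u \<in> D" "v \<in> D"
  shows "lift M T (cls M u + cls M v) = lift M T (cls M u) + lift M T (cls M v)"
proof -
  have sub: "L1_subspace M D" using T by (rule linear_operator.subspace)
  then have L1: "u \<in> L1 M" "v \<in> L1 M" and D: "(\<lambda>x. u x + v x) \<in> D"
    using u by (auto simp: L1_subspace_def)
  note T1 = linear_operator.into_L1 [OF T]
  have "cls M (T (\<lambda>x. u x + v x)) = cls M (\<lambda>x. T u x + T v x)"
    using linear_operator.add [OF T u] by (subst cls_eq_iff) (auto intro: T1 L1_add u D)
  then show ?thesis
    using lift_cls [OF T D] lift_cls [OF T u(1)] lift_cls [OF T u(2)] T1 u L1 by (simp add: cls_add)
qed

lemma lift_cls_scale: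
  assumes T: "linear_operator M D T" and u: "u \<in> D"
  shows "lift M T (c *\<^sub>R cls M u) = c *\<^sub>R lift M T (cls M u)"
proof -
  have sub: "L1_subspace M D" using T by (rule linear_operator.subspace)
  then have L1: "u \<in> L1 M" and D: "(\<lambda>x. c * u x) \<in> D"
    using u by (auto simp: L1_subspace_def)
  note T1 = linear_operator.into_L1 [OF T]
  have "cls M (T (\<lambda>x. c * u x)) = cls M (\<lambda>x. c * T u x)"
    using linear_operator.scale [OF T u] by (subst cls_eq_iff) (auto intro: T1 L1_scale u D)
  then show ?thesis
    using lift_cls [OF T D] lift_cls [OF T u] T1 u L1 by (simp add: cls_scale)
qed

lemma pos_contr_lift:
  assumes "positive_contraction M T"
  shows "L_space.pos_contr (L1_classes M) (pos_classes M) (lift M T)"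
proof -
  interpret L_space "L1_classes M" "pos_classes M" by (rule L_space_L1)
  have T: "linear_operator M (L1 M) T" using assms by (simp add: positive_contraction_def)
  show ?thesis
    unfolding pos_contr_def linear_on_X_def
  proof (intro conjI ballI allI)
    fix x y c assume "x \<in> L1_classes M" "y \<in> L1_classes M"
    then show "lift M T (x + y) = lift M T x + lift M T y" "lift M T (c *\<^sub>R x) = c *\<^sub>R lift M T x"
      using lift_cls_add [OF T] lift_cls_scale [OF T] by (auto simp: L1_classes_def)
  next
    fix p assume "p \<in> pos_classes M"
    then obtain u where u: "u \<in> pos_cone M (L1 M)" "p = cls M u" by (auto simp: pos_classes_def)
    have uL1: "u \<in> L1 M" using u by (simp add: pos_cone_def)
    have Tu: "T u \<in> pos_cone M (L1 M)" "L1_norm M (T u) \<le> L1_norm M u"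
      using assms u uL1 by (auto simp: positive_contraction_def)
    show "lift M T p \<in> pos_classes M" "norm (lift M T p) \<le> norm p"
      using u uL1 Tu lift_cls [OF T uL1] by (auto simp: pos_classes_def norm_cls pos_cone_def)
  qed
qed

lemma substochastic_lift:
  assumes "substochastic_semigroup M S"
  shows "substochastic (L1_classes M) (pos_classes M) (\<lambda>t. lift M (S t))"
proof -
  interpret L_space "L1_classes M" "pos_classes M" by (rule L_space_L1)
  have pc: "positive_contraction M (S t)" if "0 \<le> t" for t
    using assms that by (simp add: substochastic_semigroup_def)
  have lin: "linear_operator M (L1 M) (S t)" if "0 \<le> t" for t
    using pc [OF that] by (simp add: positive_contraction_def)
  note L1 = linear_operator.into_L1 [OF lin]
  note lc = lift_cls [OF lin]
  have sc: "strongly_continuous_semigroup M S" using assms by (simp add: substochastic_semigroup_def)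
  show ?thesis
  proof
    fix t :: real assume "0 \<le> t"
    then show "L_space.pos_contr (L1_classes M) (pos_classes M) (lift M (S t))"
      by (intro pos_contr_lift pc)
  next
    fix x assume "x \<in> L1_classes M"
    then obtain u where u: "u \<in> L1 M" "x = cls M u" by (auto simp: L1_classes_def)
    have "eq_ae M (S 0 u) u" using sc u by (simp add: strongly_continuous_semigroup_def)
    then show "lift M (S 0) x = x" using u L1 lc by (simp add: cls_eq_iff)
    have "L1_tendsto M (\<lambda>t. S t u) u (at_right 0)" using sc u by (simp add: strongly_continuous_semigroup_def)
    then have "((\<lambda>t. cls M (S t u)) \<longlongrightarrow> x) (at_right 0)" using u by (simp add: L1_tendsto_iff)
    then show "((\<lambda>t. lift M (S t) x) \<longlongrightarrow> x) (at_right 0)"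
    proof (rule Lim_transform_eventually)
      show "\<forall>\<^sub>F t in at_right 0. cls M (S t u) = lift M (S t) x"
        using eventually_at_right_less by (rule eventually_mono) (use lc u in auto)
    qed
    fix s t :: real assume st: "0 \<le> s" "0 \<le> t"
    have "eq_ae M (S (s + t) u) (S s (S t u))"
      using sc u st by (simp add: strongly_continuous_semigroup_def)
    then show "lift M (S (s + t)) x = lift M (S s) (lift M (S t) x)"
      using u st L1 lc by (simp add: cls_eq_iff)
  qed
qed

lemma gen_lift_iff:
  assumes S: "substochastic_semigroup M S" and u: "u \<in> L1 M" and v: "v \<in> L1 M"
  shows "substochastic.gen (L1_classes M) (\<lambda>t. lift M (S t)) (cls M u) (cls M v) \<longleftrightarrow>
    L1_tendsto M (\<lambda>t x. (S t u x - u x) / t) v (at_right 0)"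
proof -
  interpret substochastic "L1_classes M" "pos_classes M" "\<lambda>t. lift M (S t)"
    using S by (rule substochastic_lift)
  have lin: "linear_operator M (L1 M) (S t)" if "0 \<le> t" for t
    using S that by (simp add: substochastic_semigroup_def positive_contraction_def)
  have SL1: "S t u \<in> L1 M" if "0 < t" for t
    using linear_operator.into_L1 [OF lin] u that by simp
  have L1: "(\<lambda>x. (S t u x - u x) / t) \<in> L1 M" if "0 < t" for t
    using L1_scale [OF L1_diff [OF SL1 [OF that] u], of "1 / t"] by simp
  have "cls M (\<lambda>x. (S t u x - u x) / t) = (lift M (S t) (cls M u) - cls M u) /\<^sub>R t" if t: "0 < t" for t
  proof -
    have "(\<lambda>x. (S t u x - u x) / t) = (\<lambda>x. inverse t * (S t u x - u x))"
      by (simp add: divide_inverse mult.commute)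
    then show ?thesis
      using cls_scale [OF L1_diff [OF SL1 [OF t] u], of "inverse t"] lift_cls [OF lin u, of t] t
      by (simp add: cls_diff SL1 u)
  qed
  then have "\<forall>\<^sub>F t in at_right 0.
      cls M (\<lambda>x. (S t u x - u x) / t) = (lift M (S t) (cls M u) - cls M u) /\<^sub>R t"
    by (intro eventually_mono [OF eventually_at_right_0_pos]) simp
  note cong = tendsto_cong [OF this]
  have "\<forall>\<^sub>F t in at_right 0. (\<lambda>x. (S t u x - u x) / t) \<in> L1 M"
    by (rule eventually_mono [OF eventually_at_right_0_pos]) (rule L1)
  moreover have "cls M u \<in> L1_classes M" "cls M v \<in> L1_classes M" using u v by (auto simp: L1_classes_def)
  ultimately show ?thesis
    unfolding gen_def L1_tendsto_iff cong using v by simp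
qed

text \<open>The abstract generator of the lifted semigroup is the image of the graph of \<open>A\<close>.\<close>
lemma gen_lift_generates:
  assumes S: "substochastic_semigroup M S" and A: "generates M D A S"
  shows "substochastic.gen (L1_classes M) (\<lambda>t. lift M (S t)) x y \<longleftrightarrow>
    (\<exists>u\<in>D. x = cls M u \<and> y = cls M (A u))" (is "?gen x y \<longleftrightarrow> ?rhs")
proof
  interpret substochastic "L1_classes M" "pos_classes M" "\<lambda>t. lift M (S t)"
    using S by (rule substochastic_lift)
  have lin: "linear_operator M D A" using A unfolding generates_def by blast
  have D: "D \<subseteq> L1 M" using linear_operator.subspace [OF lin] by (simp add: L1_subspace_def)
  have gD: "?gen (cls M u) (cls M (A u))" if "u \<in> D" for u
    using A that D linear_operator.into_L1 [OF lin that] gen_lift_iff [OF S]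
    unfolding generates_def by blast
  show ?rhs if g: "?gen x y"
  proof -
    obtain u v where uv: "u \<in> L1 M" "x = cls M u" "v \<in> L1 M" "y = cls M v"
      using genX [OF g] by (auto simp: L1_classes_def)
    then have "L1_tendsto M (\<lambda>t x. (S t u x - u x) / t) v (at_right 0)"
      using g gen_lift_iff [OF S] by simp
    then have uD: "u \<in> D" using A uv(1) unfolding generates_def by blast
    then show ?thesis using gen_unique [OF g] gD uv by blast
  qed
  show "?gen x y" if ?rhs using that gD by blast
qed

lemma L1_subspace_L1: "L1_subspace M (L1 M)"
  by (auto simp: L1_subspace_def L1_def)

section \<open>Transfer to operators on functions\<close>

lemma linear_operator_restrict:
  assumes "linear_operator M D' T" "L1_subspace M D" "D \<subseteq> D'"
  shows "linear_operator M D T"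
proof -
  interpret linear_operator M D' T by fact
  show ?thesis by unfold_locales (use assms(2,3) in \<open>auto intro: into_L1 cong add scale\<close>)
qed

text \<open>Normalisation of a nonzero positive element gives a density, and \<open>0\<close> is mapped to \<open>0\<close>.\<close>
lemma stochastic_operator_iff_norm:
  assumes T: "positive_contraction M T"
  shows "stochastic_operator M T \<longleftrightarrow> (\<forall>p\<in>pos_classes M. norm (lift M T p) = norm p)"
proof -
  have lin: "linear_operator M (L1 M) T" using T by (simp add: positive_contraction_def)
  have dens: "density_elem M u \<longleftrightarrow> u \<in> L1 M \<and> cls M u \<in> pos_classes M \<and> norm (cls M u) = 1" for u
    using cls_pos_iff [of u M] norm_cls [of u M] by (auto simp: density_elem_def pos_cone_def le_ae_def)
  note lc = lift_cls [OF lin]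
  note TL1 = linear_operator.into_L1 [OF lin]
  show ?thesis
  proof
    assume st: "stochastic_operator M T"
    show "\<forall>p\<in>pos_classes M. norm (lift M T p) = norm p"
    proof
      fix p assume p: "p \<in> pos_classes M"
      then obtain u where u: "u \<in> L1 M" "AE x in M. 0 \<le> u x" "p = cls M u"
        by (auto simp: pos_classes_def pos_cone_def le_ae_def)
      show "norm (lift M T p) = norm p"
      proof (cases "norm p = 0")
        case True
        then show ?thesis using lift_cls_scale [OF lin u(1), of 0] by simp
      next
        case False
        define c where "c = 1 / norm p"
        have c: "0 < c" "c * norm p = 1" using False by (auto simp: c_def)
        have cu: "cls M (\<lambda>x. c * u x) = c *\<^sub>R p" using u by (simp add: cls_scale)
        have "AE x in M. 0 \<le> c * u x" using u(2) c(1) by (auto elim!: eventually_mono)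
        then have "density_elem M (\<lambda>x. c * u x)"
          unfolding dens using u c cu cls_pos_iff [OF L1_scale [OF u(1)], of c] L1_scale [OF u(1)] by simp
        then have "density_elem M (T (\<lambda>x. c * u x))"
          using st unfolding stochastic_operator_def by blast
        then have "norm (lift M T (c *\<^sub>R p)) = 1"
          using lc [OF L1_scale [OF u(1)], of c] cu by (simp add: dens)
        then have "c * norm (lift M T p) = 1"
          using lift_cls_scale [OF lin u(1), of c] u(3) c by simp
        then show ?thesis using c by (simp add: c_def)
      qed
    qed
  next
    assume iso: "\<forall>p\<in>pos_classes M. norm (lift M T p) = norm p"
    show "stochastic_operator M T"
      unfolding stochastic_operator_def
    proof (intro conjI lin allI impI)
      fix u assume "density_elem M u"
      then have u: "u \<in> L1 M" "cls M u \<in> pos_classes M" "norm (cls M u) = 1" by (auto simp: dens)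
      then have "u \<in> pos_cone M (L1 M)" using cls_pos_iff [OF u(1)] by (simp add: pos_cone_def le_ae_def)
      then have "T u \<in> pos_cone M (L1 M)" using T by (simp add: positive_contraction_def)
      then have "cls M (T u) \<in> pos_classes M" by (simp add: pos_classes_def)
      then show "density_elem M (T u)"
        unfolding dens using u TL1 iso lc [OF u(1)] by metis
    qed
  qed
qed

lemma cls_sum:
  assumes "\<And>i. i \<in> I \<Longrightarrow> f i \<in> L1 M"
  shows "cls M (\<lambda>x. \<Sum>i\<in>I. f i x) = (\<Sum>i\<in>I. cls M (f i)) \<and> (\<lambda>x. \<Sum>i\<in>I. f i x) \<in> L1 M"
  using assms
proof (induction I rule: infinite_finite_induct)
  case (insert i I)
  then show ?case by (simp add: cls_add L1_add)
qed (simp_all add: cls_zero L1_def)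

theorem theorem3p6:
  fixes M :: "'a measure"
    and D\<^sub>A D\<^sub>B :: "('a \<Rightarrow> real) set"
    and A B :: "('a \<Rightarrow> real) \<Rightarrow> 'a \<Rightarrow> real"
    and S :: "real \<Rightarrow> ('a \<Rightarrow> real) \<Rightarrow> 'a \<Rightarrow> real"
  assumes "sigma_finite_measure M"
    and "linear_operator M D\<^sub>A A"
    and "linear_operator M D\<^sub>B B"
    and G1: "substochastic_semigroup M S" "generates M D\<^sub>A A S"
    and G2: "D\<^sub>A \<subseteq> D\<^sub>B" "\<And>u. u \<in> pos_cone M D\<^sub>A \<Longrightarrow> le_ae M (\<lambda>_. 0) (B u)"
    and G3: "\<And>u. u \<in> pos_cone M D\<^sub>A \<Longrightarrow> (\<integral>x. A u x + B u x \<partial>M) = 0"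
  shows "(\<forall>u\<in>L1 M. L1_tendsto M (\<lambda>l. B (resolvent M D\<^sub>A A l u)) (K_operator M D\<^sub>A A B u) (at_right 0))
    \<and> positive_contraction M (K_operator M D\<^sub>A A B)
    \<and> (stochastic_operator M (K_operator M D\<^sub>A A B) \<longleftrightarrow> strongly_stable M S)
    \<and> (mean_ergodic M (K_operator M D\<^sub>A A B) \<longrightarrow>
        (\<forall>P. smallest_perturbed_semigroup M D\<^sub>A A B P \<longrightarrow> stochastic_semigroup M P))"
proof -
  have subA: "L1_subspace M D\<^sub>A" using assms(2) by (rule linear_operator.subspace)
  then have DL1: "u \<in> L1 M" if "u \<in> D\<^sub>A" for u using that by (auto simp: L1_subspace_def)
  have linB: "linear_operator M D\<^sub>A B"
    using assms(3) subA G2(1) by (rule linear_operator_restrict)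
  note AL1 = linear_operator.into_L1 [OF assms(2)]
  note BL1 = linear_operator.into_L1 [OF linB]
  note gen_iff = gen_lift_generates [OF G1]
  note lB = lift_cls [OF linB]
  interpret substochastic "L1_classes M" "pos_classes M" "\<lambda>t. lift M (S t)"
    using G1(1) by (rule substochastic_lift)
  interpret perturbation "L1_classes M" "pos_classes M" "\<lambda>t. lift M (S t)" "lift M B"
  proof
    fix x y assume "gen x y"
    then obtain u where u: "u \<in> D\<^sub>A" "x = cls M u" "y = cls M (A u)" unfolding gen_iff by blast
    show "lift M B x \<in> L1_classes M" using u lB BL1 by (simp add: L1_classes_def)
    show "lift M B (c *\<^sub>R x) = c *\<^sub>R lift M B x" for c using lift_cls_scale [OF linB u(1)] u by simp
    show "lift M B (x + x') = lift M B x + lift M B x'" if "gen x' y'" for x' y'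
      using that lift_cls_add [OF linB u(1)] u unfolding gen_iff by auto
    assume "x \<in> pos_classes M"
    then have pos: "u \<in> pos_cone M D\<^sub>A"
      using cls_pos_iff [OF DL1 [OF u(1)]] u by (simp add: pos_cone_def le_ae_def)
    show "lift M B x \<in> pos_classes M"
      using G2(2) [OF pos] lB [OF u(1)] cls_pos_iff [OF BL1 [OF u(1)]] u(2) by (simp add: le_ae_def)
    have "y + lift M B x = cls M (\<lambda>x. A u x + B u x)"
      using u lB AL1 BL1 by (simp add: cls_add)
    then show "J (y + lift M B x) = 0"
      using J_cls [OF L1_add [OF AL1 [OF u(1)] BL1 [OF u(1)]]] G3 [OF pos] by simp
  qed

  define Ko where "Ko = K_operator M D\<^sub>A A B"
  have XL1: "cls M u \<in> L1_classes M" if "u \<in> L1 M" for u using that by (simp add: L1_classes_def)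

  \<comment> \<open>The chosen resolvent is a representative of the abstract one, and the limits agree accordingly.\<close>
  have res: "resolvent M D\<^sub>A A l u \<in> D\<^sub>A" "cls M (B (resolvent M D\<^sub>A A l u)) = T l (cls M u)"
    if l: "0 < l" and u: "u \<in> L1 M" for l u
  proof -
    define r where "r = resolvent M D\<^sub>A A l u"
    have eq: "cls M (\<lambda>x. l * v x - A v x) = l *\<^sub>R cls M v - cls M (A v)" if "v \<in> D\<^sub>A" for v
      using that DL1 AL1 by (simp add: cls_diff cls_scale L1_scale)
    have L1v: "(\<lambda>x. l * v x - A v x) \<in> L1 M" if "v \<in> D\<^sub>A" for v
      using that DL1 AL1 by (simp add: L1_diff L1_scale)
    obtain v where v: "v \<in> D\<^sub>A" "R l (cls M u) = cls M v" "l *\<^sub>R R l (cls M u) - cls M u = cls M (A v)"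
      using gen_R [OF l XL1 [OF u]] unfolding gen_iff by blast
    have "l *\<^sub>R cls M v - cls M (A v) = cls M u" using v(3) unfolding v(2) by (simp add: algebra_simps)
    then have "eq_ae M (\<lambda>x. l * v x - A v x) u"
      using eq [OF v(1)] cls_eq_iff [OF L1v [OF v(1)] u] by simp
    then have r: "r \<in> D\<^sub>A" "eq_ae M (\<lambda>x. l * r x - A r x) u"
      unfolding r_def resolvent_def using v(1)
        someI [of "\<lambda>v. v \<in> D\<^sub>A \<and> eq_ae M (\<lambda>x. l * v x - A v x) u" v] by blast+
    have "l *\<^sub>R cls M r - cls M (A r) = cls M u"
      using r eq [OF r(1)] cls_eq_iff [OF L1v [OF r(1)] u] by simp
    moreover have "gen (cls M r) (cls M (A r))" unfolding gen_iff using r by blast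
    ultimately have "R l (cls M u) = cls M r" using R_eqI l by blast
    then show "resolvent M D\<^sub>A A l u \<in> D\<^sub>A" "cls M (B (resolvent M D\<^sub>A A l u)) = T l (cls M u)"
      unfolding T_def using lB [OF r(1)] r(1) by (simp_all add: r_def)
  qed

  have lim_iff: "L1_tendsto M (\<lambda>l. B (resolvent M D\<^sub>A A l u)) v (at_right 0) \<longleftrightarrow>
      v \<in> L1 M \<and> K (cls M u) = cls M v" if u: "u \<in> L1 M" for u v
  proof -
    have "\<forall>\<^sub>F l in at_right 0. cls M (B (resolvent M D\<^sub>A A l u)) = T l (cls M u)"
      by (rule eventually_at_right_0I) (simp add: res u)
    note cong = tendsto_cong [OF this]
    have "\<forall>\<^sub>F l in at_right 0. B (resolvent M D\<^sub>A A l u) \<in> L1 M"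
      by (rule eventually_at_right_0I) (simp add: BL1 res u)
    moreover have "((\<lambda>l. T l (cls M u)) \<longlongrightarrow> cls M v) (at_right 0) \<longleftrightarrow> K (cls M u) = cls M v"
      using K_lim(1) [OF XL1 [OF u]] K_eqI [of "cls M u" "cls M v"] by metis
    ultimately show ?thesis unfolding L1_tendsto_iff cong by blast
  qed
  have K: "L1_tendsto M (\<lambda>l. B (resolvent M D\<^sub>A A l u)) (Ko u) (at_right 0)" if u: "u \<in> L1 M" for u
  proof -
    obtain v where "v \<in> L1 M" "K (cls M u) = cls M v"
      using K_lim(2) [OF XL1 [OF u]] by (auto simp: L1_classes_def)
    then have "L1_tendsto M (\<lambda>l. B (resolvent M D\<^sub>A A l u)) v (at_right 0)" using lim_iff [OF u] by simp
    then show ?thesis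
      unfolding Ko_def K_operator_def
      by (rule someI [of "\<lambda>v. L1_tendsto M (\<lambda>l. B (resolvent M D\<^sub>A A l u)) v (at_right 0)"])
  qed
  have Ko: "Ko u \<in> L1 M" "cls M (Ko u) = K (cls M u)" if "u \<in> L1 M" for u
    using K [OF that] lim_iff [OF that] by auto

  have linKo: "linear_operator M (L1 M) Ko"
  proof
    show "L1_subspace M (L1 M)" by (rule L1_subspace_L1)
    fix u assume u: "u \<in> L1 M"
    then show "Ko u \<in> L1 M" by (rule Ko)
    show "eq_ae M (Ko (\<lambda>x. c * u x)) (\<lambda>x. c * Ko u x)" for c
    proof (subst cls_eq_iff [symmetric])
      show "cls M (Ko (\<lambda>x. c * u x)) = cls M (\<lambda>x. c * Ko u x)"
        using u Ko L1_scale [OF u] XL1 by (simp add: cls_scale linear_on_X_scale [OF linear_K])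
    qed (intro Ko(1) L1_scale u)+
    fix v assume v: "v \<in> L1 M"
    show "eq_ae M (Ko u) (Ko v)" if "eq_ae M u v"
      using that cls_eq_iff [OF u v] cls_eq_iff [OF Ko(1) [OF u] Ko(1) [OF v]] Ko u v by simp
    show "eq_ae M (Ko (\<lambda>x. u x + v x)) (\<lambda>x. Ko u x + Ko v x)"
    proof (subst cls_eq_iff [symmetric])
      show "cls M (Ko (\<lambda>x. u x + v x)) = cls M (\<lambda>x. Ko u x + Ko v x)"
        using u v Ko L1_add [OF u v] XL1 by (simp add: cls_add linear_on_X_add [OF linear_K])
    qed (intro Ko(1) L1_add u v)+
  qed
  have lKo: "lift M Ko x = K x" if "x \<in> L1_classes M" for x
    using that lift_cls [OF linKo] Ko by (auto simp: L1_classes_def)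
  have pcKo: "positive_contraction M Ko"
    unfolding positive_contraction_def
  proof (intro conjI linKo ballI)
    fix u assume "u \<in> pos_cone M (L1 M)"
    then have u: "u \<in> L1 M" "cls M u \<in> pos_classes M" by (auto simp: pos_cone_def pos_classes_def)
    then show "Ko u \<in> pos_cone M (L1 M)"
      using pc_Pos [OF pc_K u(2)] Ko [OF u(1)] cls_pos_iff [OF Ko(1) [OF u(1)]]
      by (simp add: pos_cone_def le_ae_def)
  next
    fix u assume u: "u \<in> L1 M"
    show "L1_norm M (Ko u) \<le> L1_norm M u"
      using pc_norm [OF pc_K XL1 [OF u]] Ko [OF u] u by (simp add: norm_cls [symmetric])
  qed

  have linS: "linear_operator M (L1 M) (S t)" if "0 \<le> t" for t
    using G1(1) that by (simp add: substochastic_semigroup_def positive_contraction_def)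
  have stable: "strongly_stable M S \<longleftrightarrow>
      (\<forall>x\<in>L1_classes M. ((\<lambda>t. lift M (S t) x) \<longlongrightarrow> 0) at_top)"
  proof -
    have "L1_tendsto M (\<lambda>t. S t u) (\<lambda>_. 0) at_top \<longleftrightarrow>
        ((\<lambda>t. lift M (S t) (cls M u)) \<longlongrightarrow> 0) at_top" if u: "u \<in> L1 M" for u
    proof -
      have "\<forall>\<^sub>F t in at_top. cls M (S t u) = lift M (S t) (cls M u)"
        using eventually_ge_at_top [of 0] by eventually_elim (simp add: lift_cls [OF linS u])
      note cong = tendsto_cong [OF this]
      have "\<forall>\<^sub>F t in at_top. S t u \<in> L1 M"
        using eventually_ge_at_top [of 0] by eventually_elim (rule linear_operator.into_L1 [OF linS u])
      then show ?thesis unfolding L1_tendsto_iff cong cls_zero by (simp add: L1_def)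
    qed
    then show ?thesis unfolding strongly_stable_def L1_classes_def by blast
  qed
  have iso: "stochastic_operator M Ko \<longleftrightarrow> (\<forall>p\<in>pos_classes M. norm (K p) = norm p)"
    unfolding stochastic_operator_iff_norm [OF pcKo] using lKo PosX by simp
  have "stochastic_operator M Ko \<longleftrightarrow> strongly_stable M S"
    unfolding iso stable using stable_imp_K_isometric K_isometric_imp_stable by blast

  moreover have "stochastic_semigroup M P"
    if erg: "mean_ergodic M Ko" and P: "smallest_perturbed_semigroup M D\<^sub>A A B P" for P
  proof -
    have subP: "substochastic_semigroup M P" using P by (simp add: smallest_perturbed_semigroup_def)
    obtain D\<^sub>C C where C: "generates M D\<^sub>C C P" "D\<^sub>A \<subseteq> D\<^sub>C"
        "\<And>u. u \<in> D\<^sub>A \<Longrightarrow> eq_ae M (C u) (\<lambda>x. A u x + B u x)"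
      using P unfolding smallest_perturbed_semigroup_def generator_extends_sum_def by blast
    have CL1: "C u \<in> L1 M" if "u \<in> D\<^sub>C" for u
      using C(1) that unfolding generates_def by (blast intro: linear_operator.into_L1)
    have ext: "substochastic.gen (L1_classes M) (\<lambda>t. lift M (P t)) v (w + lift M B v)" if g: "gen v w" for v w
    proof -
      obtain u where u: "u \<in> D\<^sub>A" "v = cls M u" "w = cls M (A u)" using g unfolding gen_iff by blast
      have "cls M (C u) = cls M (\<lambda>x. A u x + B u x)"
        using C(3) [OF u(1)] cls_eq_iff [OF CL1 L1_add [OF AL1 BL1]] u C(2) by blast
      then have "w + lift M B v = cls M (C u)"
        using u lB AL1 BL1 by (simp add: cls_add)
      then show ?thesis unfolding gen_lift_generates [OF subP C(1)] using u C(2) by blast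
    qed
    have erg': "\<exists>v\<in>L1_classes M. (\<lambda>N. (1 / real N) *\<^sub>R (\<Sum>n<N. (K ^^ n) x)) \<longlonglongrightarrow> v"
      if x: "x \<in> L1_classes M" for x
    proof -
      obtain u where u: "u \<in> L1 M" "x = cls M u" using x unfolding L1_classes_def by blast
      have pow: "(Ko ^^ n) u \<in> L1 M \<and> cls M ((Ko ^^ n) u) = (K ^^ n) x" for n
        by (induction n) (auto simp: u Ko)
      have avg: "cls M (\<lambda>x. (1 / real N) * (\<Sum>n<N. (Ko ^^ n) u x)) = (1 / real N) *\<^sub>R (\<Sum>n<N. (K ^^ n) x)" for N
      proof -
        have sum: "(\<lambda>x. \<Sum>n<N. (Ko ^^ n) u x) \<in> L1 M"
          "cls M (\<lambda>x. \<Sum>n<N. (Ko ^^ n) u x) = (\<Sum>n<N. (K ^^ n) x)"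
          using cls_sum [of "{..<N}" "\<lambda>n. (Ko ^^ n) u" M] pow by simp_all
        show ?thesis unfolding cls_scale [OF sum(1)] sum(2) ..
      qed
      obtain v where "L1_tendsto M (\<lambda>N x. (1 / real N) * (\<Sum>n<N. (Ko ^^ n) u x)) v sequentially"
        using erg u unfolding mean_ergodic_def by blast
      then show ?thesis unfolding L1_tendsto_iff avg using XL1 by blast
    qed
    have pcP: "positive_contraction M (P t)" if "0 \<le> t" for t
      using subP that by (simp add: substochastic_semigroup_def)
    have "stochastic_operator M (P t)" if t: "0 \<le> t" for t
      unfolding stochastic_operator_iff_norm [OF pcP [OF t]]
      using mean_ergodic_imp_isometric [OF erg' substochastic_lift [OF subP] ext t] by blast
    then show ?thesis
      using subP by (simp add: stochastic_semigroup_def substochastic_semigroup_def)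
  qed
  ultimately show ?thesis
    using K pcKo unfolding Ko_def by blast
qed

end
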